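(* Let $\mathcal{K}$ be an ordered abstract class with a bigness notion $\mathbf{big}$. (1) If $\mathcal{K}$ is combinatorially Erdős–Rado witnessed by $F$, then $\mathcal{K}$ is strongly, cofinally Erdős–Rado witnessed by the function $f^{\mathcal{K},F}$. (2) If $\mathcal{K}$ is strongly, cofinally $(\mu,\chi,\mathbf{big})$-Erdős–Rado, then $\mathcal{K}$ is strongly $(\mu,\chi,\mathbf{big})$-Erdős–Rado. (3) If $\mathcal{K}$ is strongly $(\mu,\chi,\mathbf{big})$-Erdős–Rado, then for each $n<\omega$ and $\lambda<\chi$, $$(\chi)\xrightarrow{\mathcal{K}}(\lambda)^n_\mu .$$ (4) If $\mathcal{K}$ is strongly Erdős–Rado witnessed by $f$, then $\mathcal{K}$ is combinatorially Erdős–Rado witnessed by $F(\mu^+,n)=f(\mu)$.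
   Context: **Abstract classes and types.** An abstract class $\mathcal{K}$ is a class of structures in a fixed language $\tau(\mathcal{K})$ with a partial order $\leq_{\mathcal{K}}$ contained in the substructure relation, such that membership and $\leq_{\mathcal{K}}$ respect isomorphism. A $\mathcal{K}$-embedding $f:M\to N$ is an injection preserving and reflecting atomic formulas with $f(M)\leq_{\mathcal{K}}N$. $\mathcal{K}$ is ordered if $\tau(\mathcal{K})$ has a distinguished binary relation $<$ that is a total order in every member. Finite tuples $\mathbf{a}_1\in I_1$, $\mathbf{a}_2\in I_2$ have the same $\mathcal{K}$-type iff there are $J_1,\dots,J_n, I_1^*,\dots,I_{n+1}^*\in\mathcal{K}$, tuples $\mathbf{b}_\ell\in I^*_\ell$ and $\mathcal{K}$-embeddings $f_\ell:I^*_{\ell+1}\to J_\ell$ with $I_1^*=I_1$, $I_{n+1}^*=I_2$, $\mathbf{b}_1=\mathbf{a}_1$, $\mathbf{b}_{n+1}=\mathbf{a}_2$, $I_\ell^*\leq_{\mathcal{K}}J_\ell$, and $\mathbf{b}_\ell=f_\ell(\mathbf{b}_{\ell+1})$. The equivalence class is $tp_{\mathcal{K}}(\mathbf{a};I)$. $S^n_{\mathcal{K}}$ is the set of $\mathcal{K}$-types of $n$-tuples, $S^{inc,n}_{\mathcal{K}}$ those of tuples $a_1<\dots<a_n$, $S_{\mathcal{K}}=\bigcup_n S^n_{\mathcal{K}}$, $S^{inc}_{\mathcal{K}}=\bigcup_n S^{inc,n}_{\mathcal{K}}$. For $p=tp_{\mathcal{K}}(i_1,\dots,i_n;I)$ and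 $s=\{k_1<\dots<k_m\}$ a set of indices, $p^s=tp_{\mathcal{K}}(i_{k_1},\dots,i_{k_m};I)$. For a language $\tau$, $tp_\tau$ and $S_\tau$ are types in the abstract class of all $\tau$-structures with substructure (equivalently, quantifier-free types). **Bigness.** A bigness notion for $\mathcal{K}$ is a family of classes $\mathcal{K}_\mu\subseteq\mathcal{K}$ ($\mu$ a cardinal; members are called $\mu$-big) such that each $\mathcal{K}_\mu$ is nonempty; if $\mu_1\leq\mu_2$, $M\leq_{\mathcal{K}}N$ and $M\in\mathcal{K}_{\mu_2}$ then $N\in\mathcal{K}_{\mu_1}$; and every $M\in\mathcal{K}_{\aleph_0}$ realizes every type in $S_{\mathcal{K}}$. **Partition relation.** For $c:[I]^n\to\kappa$, $I_0\leq_{\mathcal{K}}I$ is type-homogeneous for $c$ iff there is $c^*:S^{inc,n}_{\mathcal{K}}\to\kappa$ with $c(\{i_1,\dots,i_n\})=c^*(tp_{\mathcal{K}}(i_1,\dots,i_n;I))$ for all $i_1<\dots<i_n$ in $I_0$. $(\lambda)\xrightarrow{\mathcal{K}}(\mu)^n_\kappa$ means: for every $\lambda$-big $I\in\mathcal{K}$ and $c:[I]^n\to\kappa$ there is a $\mu$-big $I_0\leq_{\mathcal{K}}I$ type-homogeneous for $c$. $\mathcal{K}$ is combinatorially Erdős–Rado witnessed by $F:\mathrm{Card}\times\omega\to\mathrm{Card}$ iff $(F(\mu,n))\xrightarrow{\mathcal{K}}(\mu)^n_\kappa$ for all cardinals $\kappa<\mu$ and $n<\omega$. **Blueprints.** A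 blueprint $\Phi$ proper for $\mathcal{K}$ is a function $\Phi:S^{inc}_{\mathcal{K}}\to S_\tau$, for some language $\tau=\tau(\Phi)$, sending $n$-types to $n$-types with $\Phi(p^s)=\Phi(p)^s$. **Strong Erdős–Rado.** $\mathcal{K}$ is strongly $(\mu,\chi,\mathbf{big})$-Erdős–Rado iff for all $\chi$-big $I\in\mathcal{K}$ and every injection $f:I\to M$ with $|\tau(M)|\leq\mu$, there is a blueprint $\Phi$ proper for $\mathcal{K}$ with $\tau(\Phi)=\tau(M)$ such that for all $\alpha<\chi$ and $n<\omega$ there is an $\alpha$-big $I^n_\alpha\leq_{\mathcal{K}}I$ such that for every $i_1<\dots<i_n\in I^n_\alpha$, $tp_{\tau(M)}(f(i_1),\dots,f(i_n);M)=\Phi(tp_{\mathcal{K}}(i_1,\dots,i_n;I))$. $\mathcal{K}$ is strongly, cofinally $(\mu,\chi,\mathbf{big})$-Erdős–Rado iff for every language $\tau$ with $|\tau|\leq\mu$: whenever for each cardinal $\alpha<\chi$ we have a $\tau$-structure $M_\alpha$, an $\alpha$-big $I_\alpha\in\mathcal{K}$ and an injection $f_\alpha:I_\alpha\to M_\alpha$, there is a blueprint $\Phi$ proper for $\mathcal{K}$ with $\tau(\Phi)=\tau$ such that for all $\alpha<\chi$ and $n<\omega$ there are cofinally many $\beta<\chi$ for which there is an $\alpha$-big $I'\leq_{\mathcal{K}}I_\beta$ such that for every $i_1<\dots<i_n\in I'$, $tp_\tau(f_\beta(i_1),\dots,f_\beta(i_n);M_\beta)=\Phi(tp_{\mathcal{K}}(i_1,\dots,i_n;I_\beta))$.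 "Strongly [cofinally] Erdős–Rado witnessed by $f:\mathrm{Card}\to\mathrm{Card}$" means strongly [cofinally] $(\mu,f(\mu),\mathbf{big})$-Erdős–Rado for every $\mu$. **The function $f^{\mathcal{K},F}$.** Define $\daleth^F_0=\aleph_0$, $\daleth^F_{\alpha+1}=\sup_{n<\omega}F(\daleth^F_\alpha,n)$, $\daleth^F_\delta=\sup_{\alpha<\delta}\daleth^F_\alpha$ for limit $\delta$. Put $g^{\mathcal{K}}(\mu)=\sup_{n<\omega}2^{\mu\cdot|S^n_{\mathcal{K}}|}$ and $f^{\mathcal{K},F}(\mu)=\daleth^F_{g^{\mathcal{K}}(\mu)^+}$.
   Formalization: Added to exclude counterexamples: in (1), every infinite μ has some n with F(μ,n)>μ; "witnessed by f" (1, 4) and F(μ⁺,n)=f(μ) (4) concern infinite μ only; in (3), μ≠0; in (4), f(μ)>μ⁺ for infinite μ. *)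

theory Defs
  imports Main "HOL-Library.Equipollence" "HOL-Library.Ramsey"
begin

text \<open>
  The set-theoretic background is a well-ordered type \<open>'o\<close> that plays the role of the class of
  all ordinals: its order type is a strongly inaccessible cardinal.  Sets in the sense of the
  mathematics are the small sets, those of cardinality less than \<open>'o\<close>; arbitrary sets over \<open>'o\<close>
  are the classes.  An element \<open>\<alpha>\<close> stands for the von Neumann ordinal \<open>{..<\<alpha>}\<close>.
\<close>

definition inaccessible :: "'o::wellorder itself \<Rightarrow> bool" where
  "inaccessible _ \<longleftrightarrow>
     (UNIV :: nat set) \<prec> (UNIV :: 'o set) \<and>
     (\<forall>\<alpha>::'o. {..<\<alpha>} \<prec> (UNIV :: 'o set)) \<and>
     (\<forall>\<alpha>::'o. Pow {..<\<alpha>} \<prec> (UNIV :: 'o set)) \<and>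
     (\<forall>A::'o set. A \<prec> (UNIV :: 'o set) \<longrightarrow> (\<exists>\<beta>. \<forall>\<alpha>\<in>A. \<alpha> \<le> \<beta>))"


section \<open>Ordinals and cardinals\<close>

definition is_card :: "'o::wellorder \<Rightarrow> bool" where
  "is_card \<kappa> \<longleftrightarrow> (\<forall>\<alpha><\<kappa>. \<not> {..<\<alpha>} \<approx> {..<\<kappa>})"

definition infinite_card :: "'o::wellorder \<Rightarrow> bool" where
  "infinite_card \<kappa> \<longleftrightarrow> is_card \<kappa> \<and> infinite {..<\<kappa>}"

text \<open>Meaningful only for small \<open>A\<close>.\<close>
definition cardinality :: "'a set \<Rightarrow> 'o::wellorder" where
  "cardinality A = (LEAST \<alpha>. {..<\<alpha>} \<approx> A)"

definition aleph0 :: "'o::wellorder" where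
  "aleph0 = cardinality (UNIV :: nat set)"

definition cardinal_suc :: "'o::wellorder \<Rightarrow> 'o" where
  "cardinal_suc \<mu> = (LEAST \<nu>. is_card \<nu> \<and> \<mu> < \<nu>)"

definition card_mult :: "'o::wellorder \<Rightarrow> 'o \<Rightarrow> 'o" where
  "card_mult \<kappa> \<mu> = cardinality ({..<\<kappa>} \<times> {..<\<mu>})"

definition card_pow2 :: "'o::wellorder \<Rightarrow> 'o" where
  "card_pow2 \<kappa> = cardinality (Pow {..<\<kappa>})"

definition ord_sup :: "'o::wellorder set \<Rightarrow> 'o" where
  "ord_sup A = (LEAST \<beta>. \<forall>\<alpha>\<in>A. \<alpha> \<le> \<beta>)"

definition ord_suc :: "'o::wellorder \<Rightarrow> 'o" where
  "ord_suc \<alpha> = (LEAST \<beta>. \<alpha> < \<beta>)"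

text \<open>
  In the successor case the index set of the union is the singleton of the predecessor; see the
  recursion equations below.
\<close>
function daleth :: "('o::wellorder \<Rightarrow> nat \<Rightarrow> 'o) \<Rightarrow> 'o \<Rightarrow> 'o" where
  "daleth F \<gamma> =
     (if {..<\<gamma>} = {} then aleph0
      else if \<exists>\<alpha><\<gamma>. ord_suc \<alpha> = \<gamma>
        then ord_sup (\<Union>\<alpha>\<in>{\<alpha>. \<alpha> < \<gamma> \<and> ord_suc \<alpha> = \<gamma>}. range (F (daleth F \<alpha>)))
      else ord_sup (daleth F ` {..<\<gamma>}))"
  by pat_completeness auto
termination
  by (relation "inv_image {(x, y). x < y} snd") (auto simp: wf)

declare daleth.simps [simp del]

lemma less_ord_suc:
  assumes "inaccessible TYPE('o::wellorder)"
  shows "(\<alpha>::'o) < ord_suc \<alpha>"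
proof -
  have "\<exists>\<beta>. \<alpha> < \<beta>"
  proof (rule ccontr)
    assume "\<nexists>\<beta>. \<alpha> < \<beta>"
    then have U: "(UNIV :: 'o set) = insert \<alpha> {..<\<alpha>}"
      by (auto simp: not_less_iff_gr_or_eq)
    have "infinite (UNIV :: 'o set)"
      using assms by (simp add: inaccessible_def lesspoll_def infinite_le_lepoll)
    then have "infinite {..<\<alpha>}"
      using U by (metis finite_insert)
    then have "{..<\<alpha>} \<approx> (UNIV :: 'o set)"
      unfolding U by (metis eqpoll_sym infinite_insert_eqpoll)
    then show False
      using assms by (auto simp: inaccessible_def lesspoll_def)
  qed
  then show ?thesis
    unfolding ord_suc_def by (metis LeastI)
qed

lemma ord_suc_inject:
  assumes "inaccessible TYPE('o::wellorder)" "ord_suc \<alpha> = ord_suc (\<beta>::'o)"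
  shows "\<alpha> = \<beta>"
proof (rule ccontr)
  assume "\<alpha> \<noteq> \<beta>"
  then consider "\<alpha> < \<beta>" | "\<beta> < \<alpha>" by force
  then show False
    by cases (metis Least_le assms less_ord_suc not_less ord_suc_def)+
qed

lemma daleth_zero: "{..<\<gamma>} = {} \<Longrightarrow> daleth F \<gamma> = aleph0"
  by (subst daleth.simps) simp

lemma daleth_suc:
  assumes "inaccessible TYPE('o::wellorder)"
  shows "daleth F (ord_suc (\<alpha>::'o)) = ord_sup (range (F (daleth F \<alpha>)))"
proof -
  have "{\<alpha>'. \<alpha>' < ord_suc \<alpha> \<and> ord_suc \<alpha>' = ord_suc \<alpha>} = {\<alpha>}"
    using less_ord_suc[OF assms] ord_suc_inject[OF assms] by blast
  moreover have "{..<ord_suc \<alpha>} \<noteq> {}" and "\<exists>\<alpha>'<ord_suc \<alpha>. ord_suc \<alpha>' = ord_suc \<alpha>"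
    using less_ord_suc[OF assms, of \<alpha>] by blast+
  ultimately show ?thesis
    by (subst daleth.simps) simp
qed

lemma daleth_limit:
  assumes "{..<\<delta>} \<noteq> {}" "\<And>\<alpha>. \<alpha> < \<delta> \<Longrightarrow> ord_suc \<alpha> \<noteq> \<delta>"
  shows "daleth F \<delta> = ord_sup (daleth F ` {..<\<delta>})"
  using assms by (subst daleth.simps) auto


section \<open>Languages and structures\<close>

text \<open>A symbol is a name together with its arity; symbols of arity 0 are allowed.\<close>
record 'o lang =
  Fsym :: "('o \<times> nat) set"
  Rsym :: "('o \<times> nat) set"

definition language :: "'o lang \<Rightarrow> bool" where
  "language \<tau> \<longleftrightarrow> Fsym \<tau> <+> Rsym \<tau> \<prec> (UNIV :: 'o set)"

definition lang_card_le :: "'o::wellorder lang \<Rightarrow> 'o \<Rightarrow> bool" where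
  "lang_card_le \<tau> \<mu> \<longleftrightarrow> Fsym \<tau> <+> Rsym \<tau> \<lesssim> {..<\<mu>}"

record 'o structr =
  univ :: "'o set"
  fn :: "'o \<Rightarrow> 'o list \<Rightarrow> 'o"
  rl :: "'o \<Rightarrow> 'o list \<Rightarrow> bool"

text \<open>
  Interpretations are normalised off their domain, so that equality of structures is equality
  of universes and of the interpretations of the symbols.
\<close>
definition is_struct :: "'o lang \<Rightarrow> 'o structr \<Rightarrow> bool" where
  "is_struct \<tau> M \<longleftrightarrow>
     univ M \<prec> (UNIV :: 'o set) \<and>
     (\<forall>s xs. (s, length xs) \<in> Fsym \<tau> \<and> set xs \<subseteq> univ M \<longrightarrow> fn M s xs \<in> univ M) \<and>
     (\<forall>s xs. \<not> ((s, length xs) \<in> Fsym \<tau> \<and> set xs \<subseteq> univ M) \<longrightarrow> fn M s xs = undefined) \<and>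
     (\<forall>s xs. rl M s xs \<longrightarrow> (s, length xs) \<in> Rsym \<tau> \<and> set xs \<subseteq> univ M)"

definition induced :: "'o lang \<Rightarrow> 'o structr \<Rightarrow> 'o set \<Rightarrow> 'o structr" where
  "induced \<tau> N A =
     \<lparr> univ = A,
       fn = (\<lambda>s xs. if (s, length xs) \<in> Fsym \<tau> \<and> set xs \<subseteq> A then fn N s xs else undefined),
       rl = (\<lambda>s xs. rl N s xs \<and> set xs \<subseteq> A) \<rparr>"

definition substruct :: "'o lang \<Rightarrow> 'o structr \<Rightarrow> 'o structr \<Rightarrow> bool" where
  "substruct \<tau> M N \<longleftrightarrow>
     is_struct \<tau> M \<and> is_struct \<tau> N \<and> univ M \<subseteq> univ N \<and> M = induced \<tau> N (univ M)"

datatype (tsyms: 'o, tvars: 'x) tm = Var 'x | App 'o "('o, 'x) tm list"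

datatype (asyms: 'o, avars: 'x) atm = Eq "('o, 'x) tm" "('o, 'x) tm" | Rel 'o "('o, 'x) tm list"

primrec wf_tm :: "'o lang \<Rightarrow> ('o, 'x) tm \<Rightarrow> bool" where
  "wf_tm \<tau> (Var x) \<longleftrightarrow> True"
| "wf_tm \<tau> (App s ts) \<longleftrightarrow> (s, length ts) \<in> Fsym \<tau> \<and> list_all (wf_tm \<tau>) ts"

primrec wf_atm :: "'o lang \<Rightarrow> ('o, 'x) atm \<Rightarrow> bool" where
  "wf_atm \<tau> (Eq t u) \<longleftrightarrow> wf_tm \<tau> t \<and> wf_tm \<tau> u"
| "wf_atm \<tau> (Rel s ts) \<longleftrightarrow> (s, length ts) \<in> Rsym \<tau> \<and> list_all (wf_tm \<tau>) ts"

primrec tm_val :: "'o structr \<Rightarrow> ('x \<Rightarrow> 'o) \<Rightarrow> ('o, 'x) tm \<Rightarrow> 'o" where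
  "tm_val M v (Var x) = v x"
| "tm_val M v (App s ts) = fn M s (map (tm_val M v) ts)"

primrec sat :: "'o structr \<Rightarrow> ('x \<Rightarrow> 'o) \<Rightarrow> ('o, 'x) atm \<Rightarrow> bool" where
  "sat M v (Eq t u) \<longleftrightarrow> tm_val M v t = tm_val M v u"
| "sat M v (Rel s ts) \<longleftrightarrow> rl M s (map (tm_val M v) ts)"

text \<open>Only the variables of \<open>\<phi>\<close> have to be assigned, so that closed atoms count in an empty structure.\<close>
definition embedding :: "'o lang \<Rightarrow> ('o \<Rightarrow> 'o) \<Rightarrow> 'o structr \<Rightarrow> 'o structr \<Rightarrow> bool" where
  "embedding \<tau> f M N \<longleftrightarrow>
     inj_on f (univ M) \<and> f ` univ M \<subseteq> univ N \<and>
     (\<forall>(\<phi> :: ('o, nat) atm) v. wf_atm \<tau> \<phi> \<and> v ` avars \<phi> \<subseteq> univ M \<longrightarrow>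
        (sat M v \<phi> \<longleftrightarrow> sat N (f \<circ> v) \<phi>))"

definition isomorphism :: "'o lang \<Rightarrow> ('o \<Rightarrow> 'o) \<Rightarrow> 'o structr \<Rightarrow> 'o structr \<Rightarrow> bool" where
  "isomorphism \<tau> f M N \<longleftrightarrow>
     is_struct \<tau> M \<and> is_struct \<tau> N \<and> embedding \<tau> f M N \<and> f ` univ M = univ N"


section \<open>Abstract classes and types\<close>

record 'o aclass =
  Lang :: "'o lang"
  Mem :: "'o structr set"
  Le :: "'o structr \<Rightarrow> 'o structr \<Rightarrow> bool"

definition abstract_class :: "'o aclass \<Rightarrow> bool" where
  "abstract_class K \<longleftrightarrow>
     language (Lang K) \<and>
     (\<forall>M\<in>Mem K. is_struct (Lang K) M) \<and>
     (\<forall>M N. Le K M N \<longrightarrow> M \<in> Mem K \<and> N \<in> Mem K \<and> substruct (Lang K) M N) \<and>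
     (\<forall>M\<in>Mem K. Le K M M) \<and>
     (\<forall>M N. Le K M N \<and> Le K N M \<longrightarrow> M = N) \<and>
     (\<forall>M N P. Le K M N \<and> Le K N P \<longrightarrow> Le K M P) \<and>
     (\<forall>M N f. M \<in> Mem K \<and> isomorphism (Lang K) f M N \<longrightarrow> N \<in> Mem K) \<and>
     (\<forall>M N N' f. Le K M N \<and> isomorphism (Lang K) f N N' \<longrightarrow>
        Le K (induced (Lang K) N' (f ` univ M)) N')"

definition ordered_abstract_class :: "'o aclass \<Rightarrow> 'o \<Rightarrow> bool" where
  "ordered_abstract_class K lt \<longleftrightarrow>
     abstract_class K \<and> (lt, 2) \<in> Rsym (Lang K) \<and>
     (\<forall>M\<in>Mem K.
        (\<forall>x\<in>univ M. \<not> rl M lt [x, x]) \<and>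
        (\<forall>x\<in>univ M. \<forall>y\<in>univ M. \<forall>z\<in>univ M. rl M lt [x, y] \<and> rl M lt [y, z] \<longrightarrow> rl M lt [x, z]) \<and>
        (\<forall>x\<in>univ M. \<forall>y\<in>univ M. x \<noteq> y \<longrightarrow> rl M lt [x, y] \<or> rl M lt [y, x]))"

definition K_embedding :: "'o aclass \<Rightarrow> ('o \<Rightarrow> 'o) \<Rightarrow> 'o structr \<Rightarrow> 'o structr \<Rightarrow> bool" where
  "K_embedding K f M N \<longleftrightarrow>
     M \<in> Mem K \<and> N \<in> Mem K \<and> embedding (Lang K) f M N \<and>
     Le K (induced (Lang K) N (f ` univ M)) N"

definition same_type ::
  "'o aclass \<Rightarrow> 'o list \<Rightarrow> 'o structr \<Rightarrow> 'o list \<Rightarrow> 'o structr \<Rightarrow> bool" where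
  "same_type K a\<^sub>1 I\<^sub>1 a\<^sub>2 I\<^sub>2 \<longleftrightarrow>
     (\<exists>(n::nat) J Is b f.
        Is 0 = I\<^sub>1 \<and> Is n = I\<^sub>2 \<and> b 0 = a\<^sub>1 \<and> b n = a\<^sub>2 \<and>
        (\<forall>l\<le>n. Is l \<in> Mem K \<and> set (b l) \<subseteq> univ (Is l)) \<and>
        (\<forall>l<n. J l \<in> Mem K \<and> Le K (Is l) (J l) \<and> K_embedding K (f l) (Is (Suc l)) (J l) \<and>
           b l = map (f l) (b (Suc l))))"

type_synonym 'o type = "('o list \<times> 'o structr) set"

definition tp :: "'o aclass \<Rightarrow> 'o list \<Rightarrow> 'o structr \<Rightarrow> 'o type" where
  "tp K a I = {(b, J). J \<in> Mem K \<and> set b \<subseteq> univ J \<and> same_type K a I b J}"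

definition increasing :: "'o \<Rightarrow> 'o structr \<Rightarrow> 'o list \<Rightarrow> bool" where
  "increasing lt I a \<longleftrightarrow> set a \<subseteq> univ I \<and> sorted_wrt (\<lambda>x y. rl I lt [x, y]) a"

definition types :: "'o aclass \<Rightarrow> nat \<Rightarrow> 'o type set" where
  "types K n = {tp K a I | a I. I \<in> Mem K \<and> set a \<subseteq> univ I \<and> length a = n}"

definition inc_types :: "'o aclass \<Rightarrow> 'o \<Rightarrow> nat \<Rightarrow> 'o type set" where
  "inc_types K lt n = {tp K a I | a I. I \<in> Mem K \<and> increasing lt I a \<and> length a = n}"

text \<open>The type \<open>p\<^sup>s\<close>; coordinates are numbered from 0.\<close>
definition tp_restrict :: "'o aclass \<Rightarrow> 'o type \<Rightarrow> nat set \<Rightarrow> 'o type" where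
  "tp_restrict K p s = (THE q. \<exists>(a, I)\<in>p. q = tp K (nths a s) I)"

definition all_structs :: "'o lang \<Rightarrow> 'o aclass" where
  "all_structs \<tau> = \<lparr> Lang = \<tau>, Mem = {M. is_struct \<tau> M}, Le = substruct \<tau> \<rparr>"


section \<open>Bigness and Erdos-Rado properties\<close>

definition bigness :: "'o::wellorder aclass \<Rightarrow> ('o \<Rightarrow> 'o structr set) \<Rightarrow> bool" where
  "bigness K big \<longleftrightarrow>
     (\<forall>\<mu>. is_card \<mu> \<longrightarrow> big \<mu> \<subseteq> Mem K \<and> big \<mu> \<noteq> {}) \<and>
     (\<forall>\<mu>\<^sub>1 \<mu>\<^sub>2 M N. is_card \<mu>\<^sub>1 \<and> is_card \<mu>\<^sub>2 \<and> \<mu>\<^sub>1 \<le> \<mu>\<^sub>2 \<and> Le K M N \<and> M \<in> big \<mu>\<^sub>2 \<longrightarrow> N \<in> big \<mu>\<^sub>1) \<and>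
     (\<forall>M\<in>big aleph0. \<forall>n. \<forall>p\<in>types K n. \<exists>a. set a \<subseteq> univ M \<and> tp K a M = p)"

definition type_homogeneous ::
  "'o::wellorder aclass \<Rightarrow> 'o \<Rightarrow> 'o \<Rightarrow> nat \<Rightarrow> 'o structr \<Rightarrow> ('o set \<Rightarrow> 'o) \<Rightarrow> 'o structr \<Rightarrow> bool" where
  "type_homogeneous K lt \<kappa> n I c I\<^sub>0 \<longleftrightarrow>
     (\<exists>c'. c' ` inc_types K lt n \<subseteq> {..<\<kappa>} \<and>
        (\<forall>a. increasing lt I\<^sub>0 a \<and> length a = n \<longrightarrow> c (set a) = c' (tp K a I)))"

text \<open>\<open>arrows K lt big \<theta> \<mu> n \<kappa>\<close> is the relation \<open>(\<theta>) \<longrightarrow> (\<mu>)\<close> with exponent \<open>n\<close> and \<open>\<kappa>\<close> colours.\<close>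
definition arrows ::
  "'o::wellorder aclass \<Rightarrow> 'o \<Rightarrow> ('o \<Rightarrow> 'o structr set) \<Rightarrow> 'o \<Rightarrow> 'o \<Rightarrow> nat \<Rightarrow> 'o \<Rightarrow> bool" where
  "arrows K lt big \<theta> \<mu> n \<kappa> \<longleftrightarrow>
     (\<forall>I\<in>big \<theta>. \<forall>c. c ` nsets (univ I) n \<subseteq> {..<\<kappa>} \<longrightarrow>
        (\<exists>I\<^sub>0\<in>big \<mu>. Le K I\<^sub>0 I \<and> type_homogeneous K lt \<kappa> n I c I\<^sub>0))"

definition combinatorially_ER ::
  "'o::wellorder aclass \<Rightarrow> 'o \<Rightarrow> ('o \<Rightarrow> 'o structr set) \<Rightarrow> ('o \<Rightarrow> nat \<Rightarrow> 'o) \<Rightarrow> bool" where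
  "combinatorially_ER K lt big F \<longleftrightarrow>
     (\<forall>\<mu> n. is_card \<mu> \<longrightarrow> is_card (F \<mu> n)) \<and>
     (\<forall>\<mu> \<kappa> n. is_card \<mu> \<and> is_card \<kappa> \<and> \<kappa> < \<mu> \<longrightarrow> arrows K lt big (F \<mu> n) \<mu> n \<kappa>)"

definition blueprint :: "'o aclass \<Rightarrow> 'o \<Rightarrow> 'o lang \<Rightarrow> ('o type \<Rightarrow> 'o type) \<Rightarrow> bool" where
  "blueprint K lt \<tau> \<Phi> \<longleftrightarrow>
     (\<forall>n. \<forall>p\<in>inc_types K lt n.
        \<Phi> p \<in> types (all_structs \<tau>) n \<and>
        (\<forall>s\<subseteq>{..<n}. \<Phi> (tp_restrict K p s) = tp_restrict (all_structs \<tau>) (\<Phi> p) s))"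

definition strongly_ER ::
  "'o::wellorder aclass \<Rightarrow> 'o \<Rightarrow> ('o \<Rightarrow> 'o structr set) \<Rightarrow> 'o \<Rightarrow> 'o \<Rightarrow> bool" where
  "strongly_ER K lt big \<mu> \<chi> \<longleftrightarrow>
     (\<forall>I\<in>big \<chi>. \<forall>\<tau> M f.
        language \<tau> \<and> lang_card_le \<tau> \<mu> \<and> is_struct \<tau> M \<and>
        inj_on f (univ I) \<and> f ` univ I \<subseteq> univ M \<longrightarrow>
        (\<exists>\<Phi>. blueprint K lt \<tau> \<Phi> \<and>
           (\<forall>\<alpha> n. is_card \<alpha> \<and> \<alpha> < \<chi> \<longrightarrow>
              (\<exists>I'\<in>big \<alpha>. Le K I' I \<and>
                 (\<forall>a. increasing lt I' a \<and> length a = n \<longrightarrow>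
                    tp (all_structs \<tau>) (map f a) M = \<Phi> (tp K a I))))))"

text \<open>
  ``Cofinally many \<open>\<beta> < \<chi>\<close>'' ranges over cardinals and means cofinal among the cardinals below \<open>\<chi>\<close>.
\<close>
definition strongly_cofinally_ER ::
  "'o::wellorder aclass \<Rightarrow> 'o \<Rightarrow> ('o \<Rightarrow> 'o structr set) \<Rightarrow> 'o \<Rightarrow> 'o \<Rightarrow> bool" where
  "strongly_cofinally_ER K lt big \<mu> \<chi> \<longleftrightarrow>
     (\<forall>\<tau> M I f.
        language \<tau> \<and> lang_card_le \<tau> \<mu> \<and>
        (\<forall>\<alpha>. is_card \<alpha> \<and> \<alpha> < \<chi> \<longrightarrow>
           is_struct \<tau> (M \<alpha>) \<and> I \<alpha> \<in> big \<alpha> \<and>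
           inj_on (f \<alpha>) (univ (I \<alpha>)) \<and> f \<alpha> ` univ (I \<alpha>) \<subseteq> univ (M \<alpha>)) \<longrightarrow>
        (\<exists>\<Phi>. blueprint K lt \<tau> \<Phi> \<and>
           (\<forall>\<alpha> n. is_card \<alpha> \<and> \<alpha> < \<chi> \<longrightarrow>
              (\<forall>\<gamma>. is_card \<gamma> \<and> \<gamma> < \<chi> \<longrightarrow>
                 (\<exists>\<beta>. is_card \<beta> \<and> \<gamma> \<le> \<beta> \<and> \<beta> < \<chi> \<and>
                    (\<exists>I'\<in>big \<alpha>. Le K I' (I \<beta>) \<and>
                       (\<forall>a. increasing lt I' a \<and> length a = n \<longrightarrow>
                          tp (all_structs \<tau>) (map (f \<beta>) a) (M \<beta>) = \<Phi> (tp K a (I \<beta>)))))))))"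

text \<open>
  The bound \<open>\<mu>\<close> on the size of the language ranges over infinite cardinals, as is usual for
  sizes of languages: one function symbol already yields infinitely many terms.
\<close>
definition strongly_ER_by ::
  "'o::wellorder aclass \<Rightarrow> 'o \<Rightarrow> ('o \<Rightarrow> 'o structr set) \<Rightarrow> ('o \<Rightarrow> 'o) \<Rightarrow> bool" where
  "strongly_ER_by K lt big f \<longleftrightarrow>
     (\<forall>\<mu>. infinite_card \<mu> \<longrightarrow> is_card (f \<mu>) \<and> strongly_ER K lt big \<mu> (f \<mu>))"

definition strongly_cofinally_ER_by ::
  "'o::wellorder aclass \<Rightarrow> 'o \<Rightarrow> ('o \<Rightarrow> 'o structr set) \<Rightarrow> ('o \<Rightarrow> 'o) \<Rightarrow> bool" where
  "strongly_cofinally_ER_by K lt big f \<longleftrightarrow>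
     (\<forall>\<mu>. infinite_card \<mu> \<longrightarrow> is_card (f \<mu>) \<and> strongly_cofinally_ER K lt big \<mu> (f \<mu>))"

definition g_K :: "'o::wellorder aclass \<Rightarrow> 'o \<Rightarrow> 'o" where
  "g_K K \<mu> = ord_sup (range (\<lambda>n. card_pow2 (card_mult \<mu> (cardinality (types K n)))))"

definition f_KF :: "'o::wellorder aclass \<Rightarrow> ('o \<Rightarrow> nat \<Rightarrow> 'o) \<Rightarrow> 'o \<Rightarrow> 'o" where
  "f_KF K F \<mu> = daleth F (cardinal_suc (g_K K \<mu>))"

end

theory Submission
  imports Defs
begin

text \<open>
  Only the first implication is deep.  It is Morley's omitting types argument, carried out with the
  partition relation of the class in place of the Erdos-Rado theorem.  Given a family of maps
  \<open>f \<beta> : I \<beta> \<rightarrow> M \<beta>\<close> into structures of a language of size at most \<open>\<mu>\<close>, with \<open>I \<beta>\<close> ranging over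
  bigger and bigger structures, a blueprint is built arity by arity.  Call \<open>\<Phi>\<close> correct below \<open>n\<close> if
  for every \<open>\<xi>\<close> below \<open>g\<^sup>+\<close>, where \<open>g = g_K K \<mu>\<close>, some \<open>I \<beta>\<close> with \<open>\<beta>\<close> at least the \<open>\<xi>\<close>-th daleth
  number has a substructure, big for that number, on which \<open>\<Phi>\<close> predicts the types of the images
  of all increasing tuples shorter than \<open>n\<close>.  To pass from \<open>n\<close> to \<open>n + 1\<close>, start one
  level higher in the hierarchy and colour the increasing \<open>n\<close>-tuples by the types of their images.
  There are at most \<open>2\<^sup>\<mu>\<close> colours, so the partition relation applies and, descending by one level,
  makes the colour a function of the type in the class.  This function depends on \<open>\<xi>\<close>, but it is
  one of at most \<open>2\<close> to the power \<open>\<mu> \<cdot> |S\<^sup>n|\<close>, hence at most \<open>g\<close>, functions, and \<open>g\<^sup>+\<close> is regular; so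
  a single function serves cofinally many \<open>\<xi>\<close>, and by monotonicity of bigness all of them.  This is
  \<open>homogeneous_stage_Suc\<close>; its combinatorial core is \<open>homogeneous_labelling\<close>, and the pigeonhole
  principle is \<open>pigeonhole_cardinal_suc\<close>.  That the limit is a blueprint
  (\<open>blueprint_of_stages\<close>) is read off from the tuples themselves: a big structure realises every
  type, so each value of \<open>\<Phi>\<close> is the type of the image of a tuple, and passing to subtuples commutes
  with taking images.

  The count of colours is a fact about quantifier-free types: a type of an \<open>n\<close>-tuple in the class of
  all \<open>\<tau>\<close>-structures is determined by the set of atomic formulas true of the tuple
  (\<open>same_diagram_imp_same_type\<close>), and there are at most \<open>\<mu>\<close> atomic formulas.

  The second implication is the case of a constant family.  For the third, a colouring
  of \<open>n\<close>-subsets is coded by \<open>n\<close>-ary relations, one for each colour, so that the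
  type of a tuple determines its colour.  The fourth follows from the third by choosing, for
  each cardinal, an infinite cardinal that bounds the numbers of colours to be handled.
\<close>


section \<open>Cardinality bounds below an infinite set\<close>

lemma UNION_lepoll_infinite:
  assumes "infinite B" "I \<lesssim> B" "\<And>i. i \<in> I \<Longrightarrow> A i \<lesssim> B"
  shows "(\<Union>i\<in>I. A i) \<lesssim> B"
  using assms card_of_UNION_ordLeq_infinite[of B I A]
  by (simp add: lepoll_def card_of_ordLeq)

lemma Un_lepoll_infinite:
  assumes "infinite C" "A \<lesssim> C" "B \<lesssim> C"
  shows "A \<union> B \<lesssim> C"
proof -
  have "(UNIV :: bool set) \<lesssim> C" using assms(1) by (intro finite_lepoll_infinite) auto
  then have "(\<Union>c. if c then A else B) \<lesssim> C"
    using assms by (intro UNION_lepoll_infinite) auto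
  then show ?thesis by (simp add: UNIV_bool Un_commute)
qed

lemma times_lepoll_infinite:
  assumes "infinite C" "A \<lesssim> C" "B \<lesssim> C"
  shows "A \<times> B \<lesssim> C"
proof -
  have "ordLeq3 (card_of A) (card_of C)" "ordLeq3 (card_of B) (card_of C)"
    using assms by (simp_all add: lepoll_def card_of_ordLeq)
  then have "ordLeq3 (card_of (A \<times> B)) (card_of C)"
    using card_of_Times_ordLeq_infinite_Field card_of_Card_order assms(1) Field_card_of by metis
  then show ?thesis by (simp add: lepoll_def card_of_ordLeq)
qed

lemma Pow_lepoll_mono: "A \<lesssim> B \<Longrightarrow> Pow A \<lesssim> Pow B"
  unfolding lepoll_def by (meson Pow_mono image_Pow_mono inj_on_image_Pow)

lemma infinite_lepoll_mono: "A \<lesssim> B \<Longrightarrow> infinite A \<Longrightarrow> infinite B"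
  by (meson infinite_le_lepoll lepoll_trans)

lemma lists_of_length_lepoll_infinite:
  assumes "infinite C" "A \<lesssim> C"
  shows "{xs. length xs = n \<and> set xs \<subseteq> A} \<lesssim> C"
proof (induction n)
  case 0
  obtain c where "c \<in> C" using assms(1) by fastforce
  moreover have "{xs. length xs = 0 \<and> set xs \<subseteq> A} = {[]}" by auto
  ultimately show ?case by (metis insert_absorb singleton_lepoll singleton_eqpoll lepoll_trans1)
next
  case (Suc n)
  have "{xs. length xs = Suc n \<and> set xs \<subseteq> A}
      \<subseteq> (\<lambda>(x, xs). x # xs) ` (A \<times> {xs. length xs = n \<and> set xs \<subseteq> A})"
    by (auto simp: image_iff length_Suc_conv)
  then show ?case
    by (rule lepoll_trans[OF subset_image_lepoll times_lepoll_infinite[OF assms Suc.IH]])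
qed


section \<open>Ordinals and cardinals in an inaccessible well-order\<close>

text \<open>
  A well-order strictly longer than the cardinal of \<open>A\<close> has an initial segment isomorphic to that
  cardinal; the order type of \<open>'o\<close> is at least the cardinal of its underlying set.
\<close>
lemma exists_eqpoll_initial_segment:
  assumes "A \<prec> (UNIV :: 'o::wellorder set)"
  shows "\<exists>\<alpha>::'o. {..<\<alpha>} \<approx> A"
proof -
  define r where "r = {(x, y::'o). x \<le> y}"
  have fld: "Field r = UNIV" by (auto simp: r_def Field_def)
  have W: "Well_order r"
  proof -
    have "wf (r - Id)"
      by (rule wf_subset[OF wf]) (auto simp: r_def)
    then show ?thesis
      unfolding well_order_on_def linear_order_on_def partial_order_on_def preorder_on_def fld
      by (auto simp: r_def refl_on_def trans_def antisym_def total_on_def)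
  qed
  have "ordLess2 (card_of A) (card_of (UNIV::'o set))"
    using assms by (metis card_of_Well_order card_of_ordLeq lepoll_def lesspoll_def
        not_ordLess_iff_ordLeq not_ordLess_ordLeq lepoll_antisym)
  also have "ordLeq3 (card_of (UNIV::'o set)) r"
    using card_of_least[of UNIV r] W fld by simp
  finally have "ordLess2 (card_of A) r" .
  then obtain a where a: "ordIso2 (card_of A) (Restr r (underS r a))"
    using ordLess_iff_ordIso_Restr[OF W card_of_Well_order] by blast
  have u: "underS r a = {..<a}" by (auto simp: underS_def r_def)
  have "Field (Restr r (underS r a)) = {..<a}"
    unfolding u by (auto simp: Field_def r_def)
  moreover obtain f where "iso (card_of A) (Restr r (underS r a)) f"
    using a unfolding ordIso_def by blast
  ultimately have "bij_betw f A {..<a}"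
    unfolding iso_def by (simp add: Field_card_of)
  then show ?thesis using eqpoll_def eqpoll_sym by blast
qed

lemma cardinality_eqpoll:
  assumes "A \<prec> (UNIV :: 'o::wellorder set)"
  shows "{..<cardinality A :: 'o} \<approx> A"
  unfolding cardinality_def using exists_eqpoll_initial_segment[OF assms] by (rule LeastI_ex)

lemma lepoll_cardinality:
  "A \<prec> (UNIV :: 'o::wellorder set) \<Longrightarrow> A \<lesssim> {..<cardinality A :: 'o}"
  by (intro eqpoll_imp_lepoll eqpoll_sym[OF cardinality_eqpoll])

lemma is_card_cardinality:
  assumes "A \<prec> (UNIV :: 'o::wellorder set)"
  shows "is_card (cardinality A :: 'o)"
  unfolding is_card_def
proof (intro allI impI notI)
  fix \<alpha> :: 'o assume "\<alpha> < cardinality A" and "{..<\<alpha>} \<approx> {..<cardinality A :: 'o}"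
  then have "{..<\<alpha>} \<approx> A" using cardinality_eqpoll[OF assms] eqpoll_trans by blast
  then show False
    using \<open>\<alpha> < cardinality A\<close> unfolding cardinality_def by (metis not_less_Least)
qed

lemma is_card_lepoll_iff:
  assumes "is_card (\<kappa>::'o::wellorder)"
  shows "{..<\<kappa>} \<lesssim> {..<\<alpha>} \<longleftrightarrow> \<kappa> \<le> \<alpha>"
proof
  assume *: "{..<\<kappa>} \<lesssim> {..<\<alpha>}"
  show "\<kappa> \<le> \<alpha>"
  proof (rule ccontr)
    assume "\<not> \<kappa> \<le> \<alpha>"
    then have "\<alpha> < \<kappa>" by simp
    then have "{..<\<alpha>} \<lesssim> {..<\<kappa>}" by (intro subset_imp_lepoll) auto
    then show False using * lepoll_antisym assms \<open>\<alpha> < \<kappa>\<close> unfolding is_card_def by blast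
  qed
qed (auto intro: subset_imp_lepoll)

context
  assumes inacc: "inaccessible TYPE('o::wellorder)"
begin

lemma small_initial_segment: "{..<\<alpha>::'o} \<prec> (UNIV :: 'o set)"
  using inacc unfolding inaccessible_def by blast

lemma small_Pow_initial_segment: "Pow {..<\<alpha>::'o} \<prec> (UNIV :: 'o set)"
  using inacc unfolding inaccessible_def by blast

lemma small_nat: "(UNIV :: nat set) \<prec> (UNIV :: 'o set)"
  using inacc unfolding inaccessible_def by blast

lemma infinite_UNIV_ord: "infinite (UNIV :: 'o set)"
  using small_nat lesspoll_imp_lepoll infinite_le_lepoll by blast

lemma small_image: "A \<prec> (UNIV :: 'o set) \<Longrightarrow> f ` A \<prec> (UNIV :: 'o set)"
  by (rule lesspoll_trans1[OF image_lepoll])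

lemma small_times:
  assumes "A \<prec> (UNIV :: 'o set)" "B \<prec> (UNIV :: 'o set)"
  shows "A \<times> B \<prec> (UNIV :: 'o set)"
proof -
  obtain \<alpha> \<beta> :: 'o where ab: "{..<\<alpha>} \<approx> A" "{..<\<beta>} \<approx> B"
    using assms exists_eqpoll_initial_segment by meson
  have "{..<\<alpha>} \<lesssim> {..<max \<alpha> \<beta>}" "{..<\<beta>} \<lesssim> {..<max \<alpha> \<beta>}"
    by (auto intro!: subset_imp_lepoll)
  then have ab': "A \<lesssim> {..<max \<alpha> \<beta>}" "B \<lesssim> {..<max \<alpha> \<beta>}"
    using ab by (meson eqpoll_sym lepoll_trans1)+
  show ?thesis
  proof (cases "infinite {..<max \<alpha> \<beta>}")
    case True
    then show ?thesis
      by (rule lesspoll_trans1[OF times_lepoll_infinite[OF _ ab'] small_initial_segment])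
  next
    case False
    then have "finite A" "finite B"
      using infinite_lepoll_mono[OF ab'(1)] infinite_lepoll_mono[OF ab'(2)] by blast+
    then have "finite (A \<times> B)" by simp
    then show ?thesis by (rule finite_lesspoll_infinite[OF infinite_UNIV_ord])
  qed
qed

lemma small_lists_of_length:
  assumes "A \<prec> (UNIV :: 'o set)"
  shows "{xs. length xs = n \<and> set xs \<subseteq> A} \<prec> (UNIV :: 'o set)"
proof (induction n)
  case 0
  have "finite {xs. length xs = 0 \<and> set xs \<subseteq> A}" by simp
  then show ?case by (rule finite_lesspoll_infinite[OF infinite_UNIV_ord])
next
  case (Suc n)
  have "{xs. length xs = Suc n \<and> set xs \<subseteq> A}
      \<subseteq> (\<lambda>(x, xs). x # xs) ` (A \<times> {xs. length xs = n \<and> set xs \<subseteq> A})"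
    by (auto simp: image_iff length_Suc_conv)
  then show ?case
    by (rule lesspoll_trans1[OF subset_image_lepoll small_times[OF assms Suc.IH]])
qed

lemma ord_sup_upper:
  assumes "A \<prec> (UNIV :: 'o set)" "\<alpha> \<in> A"
  shows "\<alpha> \<le> (ord_sup A :: 'o)"
proof -
  have "\<exists>\<beta>. \<forall>\<alpha>\<in>A. \<alpha> \<le> \<beta>" using inacc assms(1) unfolding inaccessible_def by blast
  from LeastI_ex[OF this] show ?thesis using assms(2) unfolding ord_sup_def by blast
qed

lemma less_ord_supD:
  assumes "\<beta> < (ord_sup A :: 'o)"
  shows "\<exists>\<alpha>\<in>A. \<beta> < \<alpha>"
  using not_less_Least[OF assms[unfolded ord_sup_def]] by (auto simp: not_le)

text \<open>
  An ordinal equipollent to the supremum but below it would lie below some cardinal \<open>\<kappa>\<close> of the set,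
  and then \<open>\<kappa>\<close> would be equipollent to it as well.
\<close>
lemma is_card_ord_sup:
  assumes "A \<prec> (UNIV :: 'o set)" "\<And>\<kappa>. \<kappa> \<in> A \<Longrightarrow> is_card \<kappa>"
  shows "is_card (ord_sup A :: 'o)"
  unfolding is_card_def
proof (intro allI impI notI)
  fix \<alpha> assume \<alpha>: "\<alpha> < ord_sup A" "{..<\<alpha>} \<approx> {..<ord_sup A}"
  obtain \<kappa> where \<kappa>: "\<kappa> \<in> A" "\<alpha> < \<kappa>" using less_ord_supD[OF \<alpha>(1)] by blast
  have "{..<\<kappa>} \<lesssim> {..<ord_sup A}"
    using ord_sup_upper[OF assms(1) \<kappa>(1)] by (auto intro: subset_imp_lepoll)
  then have "{..<\<kappa>} \<lesssim> {..<\<alpha>}"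
    using \<alpha>(2) eqpoll_sym lepoll_trans2 by blast
  then show False using is_card_lepoll_iff assms(2) \<kappa> by fastforce
qed

lemma infinite_card_aleph0: "infinite_card (aleph0 :: 'o)"
  using cardinality_eqpoll[OF small_nat] is_card_cardinality[OF small_nat] eqpoll_finite_iff
  by (fastforce simp: infinite_card_def aleph0_def)

lemma aleph0_le_infinite_card:
  assumes "infinite_card (\<kappa>::'o)"
  shows "aleph0 \<le> \<kappa>"
proof -
  have "(UNIV::nat set) \<lesssim> {..<\<kappa>}" using assms infinite_le_lepoll infinite_card_def by blast
  then have "{..<aleph0::'o} \<lesssim> {..<\<kappa>}"
    using cardinality_eqpoll[OF small_nat] lepoll_trans1 unfolding aleph0_def by blast
  then show ?thesis using is_card_lepoll_iff infinite_card_aleph0 infinite_card_def by blast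
qed

lemma infinite_card_mono:
  assumes "infinite_card (\<kappa>::'o)" "is_card \<mu>" "\<kappa> \<le> \<mu>"
  shows "infinite_card \<mu>"
proof -
  have "{..<\<kappa>} \<subseteq> {..<\<mu>}" using assms(3) by auto
  then show ?thesis using assms infinite_super unfolding infinite_card_def by blast
qed

lemma cardinal_suc: "is_card (cardinal_suc \<mu>) \<and> \<mu> < (cardinal_suc \<mu> :: 'o)"
proof -
  let ?\<nu> = "cardinality (Pow {..<\<mu>}) :: 'o"
  have "\<mu> < ?\<nu>"
  proof (rule ccontr)
    assume "\<not> \<mu> < ?\<nu>"
    then have "{..<?\<nu>} \<lesssim> {..<\<mu>}" by (auto intro: subset_imp_lepoll)
    then have "Pow {..<\<mu>} \<lesssim> {..<\<mu>}"
      using cardinality_eqpoll[OF small_Pow_initial_segment] eqpoll_sym lepoll_trans1 by blast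
    then show False using lesspoll_Pow_self by (metis lesspoll_def lesspoll_trans1 lesspoll_not_refl)
  qed
  then have "\<exists>\<nu>. is_card \<nu> \<and> \<mu> < \<nu>"
    using is_card_cardinality[OF small_Pow_initial_segment] by blast
  then show ?thesis unfolding cardinal_suc_def by (rule LeastI_ex)
qed

lemma cardinal_suc_least: "is_card \<nu> \<Longrightarrow> \<mu> < \<nu> \<Longrightarrow> cardinal_suc \<mu> \<le> (\<nu>::'o)"
  unfolding cardinal_suc_def by (rule Least_le) blast

lemma cardinal_suc_inject:
  assumes "is_card \<mu>" "is_card \<nu>" "cardinal_suc \<mu> = (cardinal_suc \<nu> :: 'o)"
  shows "\<mu> = \<nu>"
  using assms cardinal_suc cardinal_suc_least by (metis leD linorder_neqE)

lemma initial_segment_lepoll_of_less_cardinal_suc: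
  assumes "\<xi> < (cardinal_suc \<mu> :: 'o)"
  shows "{..<\<xi>} \<lesssim> {..<\<mu>}"
proof -
  let ?\<nu> = "cardinality {..<\<xi>} :: 'o"
  have "is_card ?\<nu>" using is_card_cardinality small_initial_segment by blast
  moreover have "?\<nu> \<le> \<xi>" unfolding cardinality_def by (rule Least_le) simp
  ultimately have "\<not> \<mu> < ?\<nu>" using cardinal_suc_least assms by (meson leD le_less_trans)
  then have "{..<?\<nu>} \<lesssim> {..<\<mu>}" by (auto intro: subset_imp_lepoll)
  then show ?thesis
    using cardinality_eqpoll[OF small_initial_segment] eqpoll_sym lepoll_trans1 by blast
qed

text \<open>
  Regularity of \<open>\<mu>\<^sup>+\<close> in the form in which it is used: otherwise every fibre of \<open>h\<close> is bounded below
  \<open>\<mu>\<^sup>+\<close>, and \<open>\<mu>\<^sup>+\<close> is a union of at most \<open>\<mu>\<close> sets of size at most \<open>\<mu>\<close>.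
\<close>
lemma pigeonhole_cardinal_suc:
  assumes "infinite {..<\<mu>::'o}" and Y: "h ` {..<cardinal_suc \<mu>} \<lesssim> {..<\<mu>}"
  shows "\<exists>y. \<forall>\<xi><cardinal_suc \<mu>. \<exists>\<eta>. \<xi> \<le> \<eta> \<and> \<eta> < cardinal_suc \<mu> \<and> h \<eta> = y"
proof (rule ccontr)
  let ?l = "cardinal_suc \<mu>"
  assume "\<not> ?thesis"
  then have "\<forall>y. \<exists>\<xi><?l. \<forall>\<eta>. \<xi> \<le> \<eta> \<longrightarrow> \<eta> < ?l \<longrightarrow> h \<eta> \<noteq> y" by blast
  then obtain b where b: "\<And>y. b y < ?l" "\<And>y \<eta>. b y \<le> \<eta> \<Longrightarrow> \<eta> < ?l \<Longrightarrow> h \<eta> \<noteq> y" by metis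
  have "{..<?l} \<lesssim> (\<Union>y\<in>h ` {..<?l}. {..<b y})"
    using b(2) by (intro subset_imp_lepoll) (fastforce simp: not_le[symmetric])
  also have "(\<Union>y\<in>h ` {..<?l}. {..<b y}) \<lesssim> {..<\<mu>}"
    by (rule UNION_lepoll_infinite[OF assms(1) Y])
      (rule initial_segment_lepoll_of_less_cardinal_suc[OF b(1)])
  finally have "{..<?l} \<lesssim> {..<\<mu>}" .
  then show False using is_card_lepoll_iff[of ?l \<mu>] cardinal_suc[of \<mu>] by auto
qed

lemma ord_suc_least: "\<alpha> < \<beta> \<Longrightarrow> ord_suc \<alpha> \<le> (\<beta>::'o)"
  unfolding ord_suc_def by (rule Least_le)

lemma infinite_card_is_limit:
  assumes "infinite_card (\<kappa>::'o)" "\<alpha> < \<kappa>"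
  shows "ord_suc \<alpha> < \<kappa>"
proof (rule ccontr)
  assume "\<not> ord_suc \<alpha> < \<kappa>"
  then have "\<kappa> = ord_suc \<alpha>" using ord_suc_least[OF assms(2)] by simp
  moreover have "{..<ord_suc \<alpha>} = insert \<alpha> {..<\<alpha>}"
    using less_ord_suc[OF inacc, of \<alpha>] ord_suc_least by (auto simp: not_le[symmetric]) 
  moreover have "infinite {..<\<kappa>}" using assms(1) infinite_card_def by blast
  ultimately have "{..<\<alpha>} \<approx> {..<\<kappa>}"
    using infinite_insert_eqpoll eqpoll_sym finite_insert by metis
  then show False using assms unfolding infinite_card_def is_card_def by blast
qed

lemma small_range_nat: "range (h :: nat \<Rightarrow> 'o) \<prec> (UNIV :: 'o set)"
  using small_image[OF small_nat] .

text \<open>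
  The two claims are proved together, because strict growth at a successor step is assumed only for
  infinite cardinals.
\<close>
lemma daleth_increasing:
  assumes F: "\<And>\<mu> n. is_card \<mu> \<Longrightarrow> is_card (F \<mu> n :: 'o)"
    and inc: "\<And>\<mu>. infinite_card \<mu> \<Longrightarrow> \<exists>n. \<mu> < F \<mu> n"
  shows "infinite_card (daleth F \<beta>) \<and> (\<forall>\<alpha><\<beta>. daleth F \<alpha> < daleth F \<beta>)"
proof (induction \<beta> rule: less_induct)
  case (less \<beta>)
  consider (zero) "{..<\<beta>} = {}" | (suc) \<alpha> where "\<beta> = ord_suc \<alpha>"
    | (lim) "{..<\<beta>} \<noteq> {}" "\<And>\<alpha>. \<alpha> < \<beta> \<Longrightarrow> ord_suc \<alpha> \<noteq> \<beta>" by blast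
  then show ?case
  proof cases
    case zero
    then show ?thesis using daleth_zero[of \<beta> F] infinite_card_aleph0 by auto
  next
    case suc
    have I: "infinite_card (daleth F \<alpha>)" "\<And>\<gamma>. \<gamma> < \<alpha> \<Longrightarrow> daleth F \<gamma> < daleth F \<alpha>"
      using less.IH less_ord_suc[OF inacc] suc by blast+
    have eq: "daleth F \<beta> = ord_sup (range (F (daleth F \<alpha>)))"
      unfolding suc by (rule daleth_suc[OF inacc])
    have c: "is_card (daleth F \<beta>)"
      unfolding eq using is_card_ord_sup[OF small_range_nat] F I(1) infinite_card_def by blast
    obtain n where "daleth F \<alpha> < F (daleth F \<alpha>) n" using inc I(1) by blast
    moreover have "F (daleth F \<alpha>) n \<le> daleth F \<beta>"
      unfolding eq by (rule ord_sup_upper[OF small_range_nat]) simp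
    ultimately have lt: "daleth F \<alpha> < daleth F \<beta>" by simp
    have "daleth F \<gamma> < daleth F \<beta>" if "\<gamma> < \<beta>" for \<gamma>
    proof -
      have "\<gamma> \<le> \<alpha>" using that ord_suc_least[of \<alpha> \<gamma>] suc by (metis leD not_le)
      then show ?thesis using I(2) lt by (metis le_less less_trans)
    qed
    then show ?thesis using infinite_card_mono[OF I(1) c] lt by auto
  next
    case lim
    have eq: "daleth F \<beta> = ord_sup (daleth F ` {..<\<beta>})" using daleth_limit[OF lim] .
    have sm: "daleth F ` {..<\<beta>} \<prec> (UNIV::'o set)" using small_image[OF small_initial_segment] .
    have c: "is_card (daleth F \<beta>)"
      unfolding eq using less.IH by (intro is_card_ord_sup[OF sm]) (auto simp: infinite_card_def)
    have up: "daleth F \<gamma> \<le> daleth F \<beta>" if "\<gamma> < \<beta>" for \<gamma>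
      unfolding eq using that by (intro ord_sup_upper[OF sm]) auto
    have "daleth F \<gamma> < daleth F \<beta>" if "\<gamma> < \<beta>" for \<gamma>
    proof -
      have "ord_suc \<gamma> < \<beta>" using that lim(2) ord_suc_least by (metis le_less)
      then show ?thesis
        using less.IH less_ord_suc[OF inacc] up by (meson less_le_trans)
    qed
    moreover obtain \<gamma> where "\<gamma> < \<beta>" using lim(1) by blast
    ultimately show ?thesis using infinite_card_mono[OF _ c] less.IH up by blast
  qed
qed

lemma le_daleth:
  assumes "\<And>\<alpha> \<beta>. \<alpha> < \<beta> \<Longrightarrow> daleth F \<alpha> < (daleth F \<beta> :: 'o)"
  shows "\<beta> \<le> daleth F \<beta>"
proof (induction \<beta> rule: less_induct)
  case (less \<beta>)
  show ?case
  proof (rule ccontr)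
    assume "\<not> \<beta> \<le> daleth F \<beta>"
    then have "daleth F \<beta> < \<beta>" by simp
    then show False using less.IH[of "daleth F \<beta>"] assms[of "daleth F \<beta>" \<beta>] by simp
  qed
qed

end


section \<open>Substructures and embeddings\<close>

text \<open>
  The definition presents \<open>M\<close> as the structure induced on \<open>univ M\<close>, an equation in which \<open>M\<close> occurs on
  both sides; this form is usable for rewriting.
\<close>
lemma substruct_iff:
  "substruct \<tau> M N \<longleftrightarrow> is_struct \<tau> M \<and> is_struct \<tau> N \<and> univ M \<subseteq> univ N \<and>
     (\<forall>s xs. (s, length xs) \<in> Fsym \<tau> \<and> set xs \<subseteq> univ M \<longrightarrow> fn M s xs = fn N s xs) \<and>
     (\<forall>s xs. set xs \<subseteq> univ M \<longrightarrow> rl M s xs = rl N s xs)"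
  (is "?L \<longleftrightarrow> ?R")
proof
  assume L: ?L
  define A where "A = univ M"
  have "M = induced \<tau> N A" using L unfolding substruct_def A_def by blast
  then have "fn M = fn (induced \<tau> N A)" "rl M = rl (induced \<tau> N A)" by simp_all
  then have "\<forall>s xs. (s, length xs) \<in> Fsym \<tau> \<and> set xs \<subseteq> A \<longrightarrow> fn M s xs = fn N s xs"
    "\<forall>s xs. set xs \<subseteq> A \<longrightarrow> rl M s xs = rl N s xs"
    by (simp_all add: induced_def)
  then show ?R using L unfolding substruct_def A_def by blast
next
  assume R: ?R
  then have st: "is_struct \<tau> M" by blast
  have "fn M = fn (induced \<tau> N (univ M))"
    using R st unfolding induced_def is_struct_def by (auto simp: fun_eq_iff)
  moreover have "rl M = rl (induced \<tau> N (univ M))"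
    using R st unfolding induced_def is_struct_def fun_eq_iff by simp metis
  moreover have "univ M = univ (induced \<tau> N (univ M))"
    by (simp add: induced_def)
  ultimately have "M = induced \<tau> N (univ M)" by simp
  then show ?L unfolding substruct_def using R by blast
qed

lemma univ_induced [simp]: "univ (induced \<tau> N A) = A"
  by (simp add: induced_def)

lemma substruct_induced:
  assumes N: "is_struct \<tau> N" and A: "A \<subseteq> univ N"
    and cl: "\<And>s xs. (s, length xs) \<in> Fsym \<tau> \<Longrightarrow> set xs \<subseteq> A \<Longrightarrow> fn N s xs \<in> A"
  shows "substruct \<tau> (induced \<tau> N A) N"
proof -
  have "A \<prec> (UNIV :: 'a set)"
    using N lesspoll_trans1[OF subset_imp_lepoll[OF A]] unfolding is_struct_def by blast
  then have "is_struct \<tau> (induced \<tau> N A)"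
    using N cl unfolding is_struct_def induced_def by auto
  then show ?thesis using N A unfolding substruct_def univ_induced by blast
qed

lemma substruct_refl: "is_struct \<tau> M \<Longrightarrow> substruct \<tau> M M"
  by (simp add: substruct_iff)

lemma substruct_trans: "substruct \<tau> M N \<Longrightarrow> substruct \<tau> N P \<Longrightarrow> substruct \<tau> M P"
  unfolding substruct_iff by (metis subset_trans)

lemma substruct_antisym: "substruct \<tau> M N \<Longrightarrow> substruct \<tau> N M \<Longrightarrow> M = N"
  using substruct_refl[of \<tau> N] unfolding substruct_def by (metis equalityI)

lemma tm_val_cong:
  "(\<And>x. x \<in> tvars t \<Longrightarrow> v x = w x) \<Longrightarrow> tm_val M v t = tm_val M w t"
proof (induction t)
  case (App s ts)
  then have "map (tm_val M v) ts = map (tm_val M w) ts" by (intro map_cong) auto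
  then show ?case by (simp only: tm_val.simps)
qed simp

lemma sat_cong:
  "(\<And>x. x \<in> avars \<phi> \<Longrightarrow> v x = w x) \<Longrightarrow> sat M v \<phi> \<longleftrightarrow> sat M w \<phi>"
proof (cases \<phi>)
  case (Eq t u)
  assume "\<And>x. x \<in> avars \<phi> \<Longrightarrow> v x = w x"
  then show ?thesis using Eq tm_val_cong[of t v w M] tm_val_cong[of u v w M] by simp
next
  case (Rel s ts)
  assume "\<And>x. x \<in> avars \<phi> \<Longrightarrow> v x = w x"
  then have "map (tm_val M v) ts = map (tm_val M w) ts"
    using Rel by (auto intro: tm_val_cong)
  then show ?thesis using Rel by (simp only: sat.simps)
qed

lemma tm_val_substruct:
  assumes "substruct \<tau> M N"
  shows "wf_tm \<tau> t \<Longrightarrow> v ` tvars t \<subseteq> univ M \<Longrightarrow>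
    tm_val M v t = tm_val N v t \<and> tm_val M v t \<in> univ M"
proof (induction t)
  case (Var x)
  then show ?case by simp
next
  case (App s ts)
  have IH: "tm_val M v t = tm_val N v t \<and> tm_val M v t \<in> univ M" if "t \<in> set ts" for t
    using App.IH[OF that] App.prems that by (auto simp: list_all_iff)
  have eq: "map (tm_val M v) ts = map (tm_val N v) ts"
    by (rule map_cong) (use IH in blast)+
  have sub: "set (map (tm_val M v) ts) \<subseteq> univ M"
    using IH unfolding set_map by blast
  have s: "(s, length (map (tm_val M v) ts)) \<in> Fsym \<tau>" using App.prems by simp
  have "fn M s (map (tm_val M v) ts) = fn N s (map (tm_val M v) ts)"
    using assms s sub unfolding substruct_iff by blast
  moreover have "fn M s (map (tm_val M v) ts) \<in> univ M"
    using assms s sub unfolding substruct_def is_struct_def by blast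
  ultimately show ?case using eq by (simp only: tm_val.simps)
qed

lemma sat_substruct:
  assumes "substruct \<tau> M N" "wf_atm \<tau> \<phi>" "v ` avars \<phi> \<subseteq> univ M"
  shows "sat M v \<phi> \<longleftrightarrow> sat N v \<phi>"
proof (cases \<phi>)
  case (Eq t u)
  then show ?thesis
    using assms(2,3) tm_val_substruct[OF assms(1), of t v] tm_val_substruct[OF assms(1), of u v]
    by (simp add: image_Un)
next
  case (Rel s ts)
  have *: "tm_val M v t = tm_val N v t \<and> tm_val M v t \<in> univ M" if "t \<in> set ts" for t
    using tm_val_substruct[OF assms(1), of t v] assms(2,3) that Rel by (auto simp: list_all_iff)
  have "map (tm_val M v) ts = map (tm_val N v) ts"
    by (rule map_cong) (use * in blast)+
  moreover have "set (map (tm_val M v) ts) \<subseteq> univ M"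
    using * unfolding set_map by blast
  ultimately have "rl M s (map (tm_val M v) ts) = rl N s (map (tm_val N v) ts)"
    using assms(1) unfolding substruct_iff by metis
  then show ?thesis using Rel by (simp only: sat.simps)
qed

lemma embedding_sat:
  fixes \<phi> :: "('o, nat) atm"
  assumes "embedding \<tau> f M N" "wf_atm \<tau> \<phi>" "v ` avars \<phi> \<subseteq> univ M"
  shows "sat M v \<phi> \<longleftrightarrow> sat N (f \<circ> v) \<phi>"
  using assms unfolding embedding_def by simp

lemma embedding_substruct: "substruct \<tau> M N \<Longrightarrow> embedding \<tau> (\<lambda>x. x) M N"
  using sat_substruct unfolding embedding_def by (fastforce simp: substruct_def comp_def)

lemma embedding_inverse:
  assumes f: "embedding \<tau> f M N" and A: "substruct \<tau> (induced \<tau> N (f ` univ M)) N"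
  shows "embedding \<tau> (inv_into (univ M) f) (induced \<tau> N (f ` univ M)) M"
proof -
  let ?g = "inv_into (univ M) f" and ?A = "induced \<tau> N (f ` univ M)"
  have "sat ?A v \<phi> \<longleftrightarrow> sat M (?g \<circ> v) \<phi>"
    if \<phi>: "wf_atm \<tau> (\<phi> :: ('a, nat) atm)" and v: "v ` avars \<phi> \<subseteq> f ` univ M" for \<phi> v
  proof -
    have "(?g \<circ> v) ` avars \<phi> \<subseteq> univ M"
      using v by (auto intro!: inv_into_into)
    then have "sat M (?g \<circ> v) \<phi> \<longleftrightarrow> sat N (f \<circ> (?g \<circ> v)) \<phi>"
      by (rule embedding_sat[OF f \<phi>])
    also have "\<dots> \<longleftrightarrow> sat N v \<phi>"
      using v by (intro sat_cong) (auto simp: image_subset_iff f_inv_into_f)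
    also have "\<dots> \<longleftrightarrow> sat ?A v \<phi>"
      using sat_substruct[OF A \<phi>, of v] v by simp
    finally show ?thesis by blast
  qed
  then show ?thesis
    unfolding embedding_def by (auto simp: inj_on_inv_into inv_into_into)
qed

text \<open>
  Embeddings are defined by atomic formulas.  The atom \<open>s(x\<^sub>0, \<dots>, x\<^sub>n\<^sub>-\<^sub>1) = x\<^sub>n\<close> shows that they
  commute with the functions.
\<close>
lemma embedding_fn:
  assumes f: "embedding \<tau> f M N" and M: "is_struct \<tau> M"
    and s: "(s, length xs) \<in> Fsym \<tau>" "set xs \<subseteq> univ M"
  shows "fn N s (map f xs) = f (fn M s xs)"
proof -
  let ?n = "length xs" and ?v = "nth (xs @ [fn M s xs])"
  let ?\<phi> = "Eq (App s (map Var [0..<?n])) (Var ?n) :: ('a, nat) atm"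
  have m: "map ?v [0..<?n] = xs"
    by (rule nth_equalityI) (auto simp: nth_append)
  have "fn M s xs \<in> univ M" using M s unfolding is_struct_def by blast
  then have "?v ` avars ?\<phi> \<subseteq> univ M" using s(2) by (auto simp: nth_append)
  moreover have "wf_atm \<tau> ?\<phi>" using s by (simp add: list_all_iff)
  ultimately have "sat M ?v ?\<phi> \<longleftrightarrow> sat N (f \<circ> ?v) ?\<phi>"
    by (intro embedding_sat[OF f])
  moreover have "sat M ?v ?\<phi>" using m by (simp add: comp_def)
  moreover have "map (f \<circ> ?v) [0..<?n] = map f xs" using m by (metis map_map)
  ultimately show ?thesis by (simp add: comp_def)
qed


section \<open>Types in an abstract class\<close>

text \<open>
  One link of the chain in the definition of equality of types, so that \<open>same_type\<close> becomes a
  reflexive transitive closure and is open to rule induction.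
\<close>
definition type_step :: "'o aclass \<Rightarrow> 'o list \<times> 'o structr \<Rightarrow> 'o list \<times> 'o structr \<Rightarrow> bool" where
  "type_step K = (\<lambda>(a, I) (b, J).
     I \<in> Mem K \<and> set a \<subseteq> univ I \<and> J \<in> Mem K \<and> set b \<subseteq> univ J \<and>
     (\<exists>N f. Le K I N \<and> K_embedding K f J N \<and> a = map f b))"

lemma same_type_iff_type_step:
  "same_type K a I b J \<longleftrightarrow> I \<in> Mem K \<and> set a \<subseteq> univ I \<and> (type_step K)\<^sup>*\<^sup>* (a, I) (b, J)"
proof
  assume "same_type K a I b J"
  then obtain n Js Is bs f where *: "Is 0 = I" "Is n = J" "bs 0 = a" "bs n = b"
    "\<And>l. l \<le> n \<Longrightarrow> Is l \<in> Mem K \<and> set (bs l) \<subseteq> univ (Is l)"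
    "\<And>l. l < n \<Longrightarrow> Js l \<in> Mem K \<and> Le K (Is l) (Js l) \<and> K_embedding K (f l) (Is (Suc l)) (Js l) \<and>
           bs l = map (f l) (bs (Suc l))"
    unfolding same_type_def by metis
  have "l \<le> n \<Longrightarrow> (type_step K)\<^sup>*\<^sup>* (bs 0, Is 0) (bs l, Is l)" for l
  proof (induction l)
    case (Suc l)
    have "type_step K (bs l, Is l) (bs (Suc l), Is (Suc l))"
      unfolding type_step_def using *(5)[of l] *(5)[of "Suc l"] *(6)[of l] Suc.prems by fastforce
    then show ?case using Suc by (meson Suc_leD rtranclp.rtrancl_into_rtrancl)
  qed simp
  then show "I \<in> Mem K \<and> set a \<subseteq> univ I \<and> (type_step K)\<^sup>*\<^sup>* (a, I) (b, J)"
    using * by fastforce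
next
  assume R: "I \<in> Mem K \<and> set a \<subseteq> univ I \<and> (type_step K)\<^sup>*\<^sup>* (a, I) (b, J)"
  then obtain n where "(type_step K ^^ n) (a, I) (b, J)" using rtranclp_power by metis
  then obtain p where p: "p 0 = (a, I)" "p n = (b, J)" "\<And>l. l < n \<Longrightarrow> type_step K (p l) (p (Suc l))"
    by (auto simp: relpowp_fun_conv)
  have "\<forall>l. \<exists>N f. l < n \<longrightarrow> Le K (snd (p l)) N \<and> K_embedding K f (snd (p (Suc l))) N \<and>
      fst (p l) = map f (fst (p (Suc l)))"
    using p(3) unfolding type_step_def by (simp add: case_prod_unfold)
  then obtain N f where Nf: "\<And>l. l < n \<Longrightarrow> Le K (snd (p l)) (N l) \<and>
      K_embedding K (f l) (snd (p (Suc l))) (N l) \<and> fst (p l) = map (f l) (fst (p (Suc l)))"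
    by metis
  have "snd (p l) \<in> Mem K \<and> set (fst (p l)) \<subseteq> univ (snd (p l))" if "l \<le> n" for l
  proof (cases l)
    case 0
    then show ?thesis using p R by simp
  next
    case (Suc k)
    then show ?thesis using p(3)[of k] that unfolding type_step_def by (simp add: case_prod_unfold)
  qed
  moreover have "N l \<in> Mem K" if "l < n" for l
    using Nf[OF that] unfolding K_embedding_def by blast
  ultimately have "\<forall>l\<le>n. (snd \<circ> p) l \<in> Mem K \<and> set ((fst \<circ> p) l) \<subseteq> univ ((snd \<circ> p) l)"
    "\<forall>l<n. N l \<in> Mem K" by simp_all
  note mem = this
  show "same_type K a I b J"
    unfolding same_type_def
    by (rule exI[of _ n], rule exI[of _ N], rule exI[of _ "snd \<circ> p"], rule exI[of _ "fst \<circ> p"],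
        rule exI[of _ f]) (use mem Nf p in simp)
qed

lemma same_type_memD:
  assumes "same_type K a I b J"
  shows "I \<in> Mem K" "set a \<subseteq> univ I" "J \<in> Mem K" "set b \<subseteq> univ J"
  using assms unfolding same_type_def by (metis order_refl le0)+

lemma same_type_refl: "I \<in> Mem K \<Longrightarrow> set a \<subseteq> univ I \<Longrightarrow> same_type K a I a I"
  by (simp add: same_type_iff_type_step)

lemma same_type_trans:
  "same_type K a I b J \<Longrightarrow> same_type K b J c N \<Longrightarrow> same_type K a I c N"
  by (auto simp: same_type_iff_type_step)

lemma same_type_step: "type_step K (a, I) (b, J) \<Longrightarrow> same_type K a I b J"
  by (auto simp: same_type_iff_type_step type_step_def)

lemma same_type_length: "same_type K a I b J \<Longrightarrow> length a = length b"
proof -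
  have "(type_step K)\<^sup>*\<^sup>* p q \<Longrightarrow> length (fst p) = length (fst q)" for p q
    by (induction rule: rtranclp_induct) (auto simp: type_step_def)
  then show "same_type K a I b J \<Longrightarrow> length a = length b"
    unfolding same_type_iff_type_step by fastforce
qed

lemma same_type_nths: "same_type K a I b J \<Longrightarrow> same_type K (nths a s) I (nths b s) J"
proof -
  have "(type_step K)\<^sup>*\<^sup>* p q \<Longrightarrow>
      (type_step K)\<^sup>*\<^sup>* (nths (fst p) s, snd p) (nths (fst q) s, snd q)" for p q
  proof (induction rule: rtranclp_induct)
    case (step q r)
    have "type_step K (nths (fst q) s, snd q) (nths (fst r) s, snd r)"
      using step(2) set_nths_subset[of "fst q" s] set_nths_subset[of "fst r" s]
      unfolding type_step_def case_prod_unfold fst_conv snd_conv by (metis nths_map subset_trans)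
    then show ?case using step(3) by (meson rtranclp.rtrancl_into_rtrancl)
  qed simp
  from this[of "(a, I)" "(b, J)"]
  show "same_type K a I b J \<Longrightarrow> same_type K (nths a s) I (nths b s) J"
    unfolding same_type_iff_type_step by (auto dest: in_set_nthsD)
qed

lemma abstract_classD:
  assumes "abstract_class K"
  shows "M \<in> Mem K \<Longrightarrow> is_struct (Lang K) M"
    and "Le K M N \<Longrightarrow> M \<in> Mem K" and "Le K M N \<Longrightarrow> N \<in> Mem K"
    and "Le K M N \<Longrightarrow> substruct (Lang K) M N"
    and "M \<in> Mem K \<Longrightarrow> Le K M M"
    and "Le K M N \<Longrightarrow> Le K N P \<Longrightarrow> Le K M P"
proof -
  have c1: "\<forall>M\<in>Mem K. is_struct (Lang K) M"
    using assms unfolding abstract_class_def by (elim conjE) assumption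
  have c2: "\<forall>M N. Le K M N \<longrightarrow> M \<in> Mem K \<and> N \<in> Mem K \<and> substruct (Lang K) M N"
    using assms unfolding abstract_class_def by (elim conjE) assumption
  have c3: "\<forall>M\<in>Mem K. Le K M M"
    using assms unfolding abstract_class_def by (elim conjE) assumption
  have c4: "\<forall>M N P. Le K M N \<and> Le K N P \<longrightarrow> Le K M P"
    using assms unfolding abstract_class_def by (elim conjE) assumption
  show "M \<in> Mem K \<Longrightarrow> is_struct (Lang K) M" using c1 by blast
  show "Le K M N \<Longrightarrow> M \<in> Mem K" "Le K M N \<Longrightarrow> N \<in> Mem K"
    "Le K M N \<Longrightarrow> substruct (Lang K) M N" using c2 by blast+
  show "M \<in> Mem K \<Longrightarrow> Le K M M" using c3 by blast
  show "Le K M N \<Longrightarrow> Le K N P \<Longrightarrow> Le K M P" using c4 by blast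
qed

lemma K_embedding_Le:
  assumes "abstract_class K" "Le K M N"
  shows "K_embedding K (\<lambda>x. x) M N"
  using assms abstract_classD[OF assms(1)] embedding_substruct
  unfolding K_embedding_def by (metis image_ident substruct_def)

text \<open>
  Let \<open>f : J \<rightarrow> N\<close> witness the step and let \<open>A\<close> be its image, so that \<open>A\<close> is a strong substructure of
  \<open>N\<close> isomorphic to \<open>J\<close>.  The inverse of \<open>f\<close> gives a step from \<open>J\<close> to \<open>A\<close>, and the inclusions of
  \<open>A\<close> and \<open>I\<close> in \<open>N\<close> give one from \<open>A\<close> to \<open>I\<close>.
\<close>
lemma type_step_reverse:
  assumes K: "abstract_class K" and "type_step K (a, I) (b, J)"
  shows "same_type K b J a I"
proof -
  obtain N f where *: "I \<in> Mem K" "set a \<subseteq> univ I" "J \<in> Mem K" "set b \<subseteq> univ J"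
    "Le K I N" "K_embedding K f J N" "a = map f b"
    using assms(2) unfolding type_step_def by auto
  let ?A = "induced (Lang K) N (f ` univ J)" and ?g = "inv_into (univ J) f"
  have f: "embedding (Lang K) f J N" and A: "Le K ?A N" and "inj_on f (univ J)"
    using *(6) unfolding K_embedding_def embedding_def by blast+
  have "?g ` f ` univ J = univ J" using \<open>inj_on f (univ J)\<close> by (simp add: inv_into_image_cancel)
  moreover have "induced (Lang K) J (univ J) = J"
    using abstract_classD(4)[OF K abstract_classD(5)[OF K *(3)]] unfolding substruct_def by simp
  ultimately have "K_embedding K ?g ?A J"
    using embedding_inverse[OF f abstract_classD(4)[OF K A]] *(3) abstract_classD[OF K] A
    unfolding K_embedding_def by simp
  moreover have "b = map ?g a"
    using *(4,7) \<open>inj_on f (univ J)\<close> by (auto simp: map_idI subset_iff)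
  moreover have "set a \<subseteq> univ ?A" using *(4,7) by auto
  ultimately have "type_step K (b, J) (a, ?A)"
    unfolding type_step_def using * abstract_classD(2,5)[OF K] A by blast
  moreover have "type_step K (a, ?A) (a, I)"
    unfolding type_step_def
    using * A abstract_classD(2)[OF K A] K_embedding_Le[OF K *(5)] \<open>set a \<subseteq> univ ?A\<close> by auto
  ultimately show ?thesis using same_type_step same_type_trans by blast
qed

lemma same_type_sym:
  assumes K: "abstract_class K" and "same_type K a I b J"
  shows "same_type K b J a I"
proof -
  have "(type_step K)\<^sup>*\<^sup>* p q \<Longrightarrow> (type_step K)\<^sup>*\<^sup>* q p" for p q
  proof (induction rule: rtranclp_induct)
    case (step q r)
    then have "(type_step K)\<^sup>*\<^sup>* r q"
      using type_step_reverse[OF K, of "fst q" "snd q" "fst r" "snd r"]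
      by (simp add: same_type_iff_type_step)
    then show ?case using step.IH by simp
  qed simp
  then show ?thesis using assms same_type_memD[OF assms(2)] by (auto simp: same_type_iff_type_step)
qed

lemma tp_eq_iff:
  assumes "abstract_class K" "I \<in> Mem K" "set a \<subseteq> univ I" "J \<in> Mem K" "set b \<subseteq> univ J"
  shows "tp K a I = tp K b J \<longleftrightarrow> same_type K a I b J"
proof
  assume "tp K a I = tp K b J"
  moreover have "(b, J) \<in> tp K b J" using assms same_type_refl by (simp add: tp_def)
  ultimately show "same_type K a I b J" by (auto simp: tp_def)
next
  assume "same_type K a I b J"
  then show "tp K a I = tp K b J"
    using same_type_sym[OF assms(1)] same_type_trans unfolding tp_def by blast
qed

lemma tp_Le:
  assumes "abstract_class K" "Le K I J" "set a \<subseteq> univ I"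
  shows "tp K a I = tp K a J"
proof -
  note D = abstract_classD[OF assms(1)]
  have "univ I \<subseteq> univ J" using D(4)[OF assms(2)] unfolding substruct_def by blast
  then have aJ: "set a \<subseteq> univ J" using assms(3) by blast
  have "Le K J J" "K_embedding K (\<lambda>x. x) I J" "a = map (\<lambda>x. x) a"
    using D(3)[OF assms(2)] D(5) K_embedding_Le[OF assms(1,2)] by simp_all
  then have "type_step K (a, J) (a, I)"
    unfolding type_step_def prod.case using assms(3) aJ D(2,3)[OF assms(2)] by blast
  then have "same_type K a I a J" using type_step_reverse[OF assms(1)] by blast
  then show ?thesis using tp_eq_iff[OF assms(1)] D(2,3)[OF assms(2)] assms(3) aJ by blast
qed

text \<open>
  The value of the definite description: restricting a chain to a set of coordinates is again a chain,
  so the restricted type does not depend on the tuple that represents the type.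
\<close>
lemma tp_restrict_tp:
  assumes "abstract_class K" "I \<in> Mem K" "set a \<subseteq> univ I"
  shows "tp_restrict K (tp K a I) s = tp K (nths a s) I"
  unfolding tp_restrict_def
proof (rule the_equality)
  show "\<exists>(b, J)\<in>tp K a I. tp K (nths a s) I = tp K (nths b s) J"
    using assms same_type_refl by (force simp: tp_def)
next
  fix q assume "\<exists>(b, J)\<in>tp K a I. q = tp K (nths b s) J"
  then obtain b J where b: "same_type K a I b J" "q = tp K (nths b s) J" by (auto simp: tp_def)
  then have "same_type K (nths a s) I (nths b s) J" using same_type_nths by blast
  then show "q = tp K (nths a s) I"
    using b(2) tp_eq_iff[OF assms(1)] same_type_memD by metis
qed

lemma same_type_sat:
  assumes K: "abstract_class K" and "same_type K a I b J"
    and \<phi>: "wf_atm (Lang K) \<phi>" "avars \<phi> \<subseteq> {..<length a}"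
  shows "sat I (nth a) \<phi> \<longleftrightarrow> sat J (nth b) \<phi>"
proof -
  have one: "sat I (nth a) \<phi> \<longleftrightarrow> sat J (nth b) \<phi>"
    if st: "type_step K (a, I) (b, J)" and v: "avars \<phi> \<subseteq> {..<length a}" for a I b J
  proof -
    obtain N f where *: "set a \<subseteq> univ I" "set b \<subseteq> univ J"
      "Le K I N" "K_embedding K f J N" "a = map f b"
      using st unfolding type_step_def by auto
    have "nth a ` avars \<phi> \<subseteq> set a" "nth b ` avars \<phi> \<subseteq> set b"
      using v *(5) by (auto intro!: nth_mem)
    then have "nth a ` avars \<phi> \<subseteq> univ I" "nth b ` avars \<phi> \<subseteq> univ J"
      using *(1,2) by blast+
    moreover have "embedding (Lang K) f J N" using *(4) unfolding K_embedding_def by simp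
    ultimately have "sat I (nth a) \<phi> \<longleftrightarrow> sat N (nth a) \<phi>"
      "sat J (nth b) \<phi> \<longleftrightarrow> sat N (f \<circ> nth b) \<phi>"
      using sat_substruct[OF abstract_classD(4)[OF K *(3)] \<phi>(1)] \<phi>(1)
      by (simp_all add: embedding_sat)
    moreover have "sat N (nth a) \<phi> \<longleftrightarrow> sat N (f \<circ> nth b) \<phi>"
      using v *(5) by (intro sat_cong) (auto simp: subset_iff)
    ultimately show ?thesis by blast
  qed
  have "(type_step K)\<^sup>*\<^sup>* p q \<Longrightarrow> avars \<phi> \<subseteq> {..<length (fst p)} \<Longrightarrow>
      length (fst p) = length (fst q) \<and> (sat (snd p) (nth (fst p)) \<phi> \<longleftrightarrow> sat (snd q) (nth (fst q)) \<phi>)" for p q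
  proof (induction rule: rtranclp_induct)
    case (step q r)
    have "length (fst q) = length (fst r)" using step(2) by (auto simp: type_step_def)
    then show ?case
      using step.IH step.prems one[of "fst q" "snd q" "fst r" "snd r"] step(2) by simp
  qed simp
  from this[of "(a, I)" "(b, J)"] show ?thesis
    using assms(2) \<phi>(2) by (simp add: same_type_iff_type_step)
qed


section \<open>Quantifier-free types\<close>

lemma all_structs_sel [simp]:
  "Lang (all_structs \<tau>) = \<tau>" "Mem (all_structs \<tau>) = {M. is_struct \<tau> M}"
  "Le (all_structs \<tau>) = substruct \<tau>"
  by (simp_all add: all_structs_def)

lemma abstract_class_all_structs:
  assumes "language \<tau>"
  shows "abstract_class (all_structs \<tau>)"
proof -
  have "substruct \<tau> (induced \<tau> N' (f ` univ M)) N'"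
    if M: "substruct \<tau> M N" and f: "isomorphism \<tau> f N N'" for M N N' f
  proof -
    have st: "is_struct \<tau> M" "is_struct \<tau> N" and sub: "univ M \<subseteq> univ N"
      and fn: "\<And>s xs. (s, length xs) \<in> Fsym \<tau> \<Longrightarrow> set xs \<subseteq> univ M \<Longrightarrow> fn M s xs = fn N s xs"
      using M unfolding substruct_iff by simp_all
    have N': "is_struct \<tau> N'" and emb: "embedding \<tau> f N N'" and img: "f ` univ N = univ N'"
      using f unfolding isomorphism_def by simp_all
    show ?thesis
    proof (rule substruct_induced[OF N'])
      show "f ` univ M \<subseteq> univ N'" using sub img by blast
      fix s xs assume s: "(s, length xs) \<in> Fsym \<tau>" and xs: "set xs \<subseteq> f ` univ M"
      have "xs \<in> lists (f ` univ M)" using xs by auto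
      then obtain ys where ys: "xs = map f ys" "set ys \<subseteq> univ M"
        unfolding lists_image by auto
      have s': "(s, length ys) \<in> Fsym \<tau>" using s ys by simp
      have "fn N' s (map f ys) = f (fn N s ys)"
        using ys(2) sub by (intro embedding_fn[OF emb st(2) s']) blast
      also have "fn N s ys = fn M s ys" using fn[OF s' ys(2)] by simp
      finally have "fn N' s xs = f (fn M s ys)" using ys(1) by simp
      moreover have "fn M s ys \<in> univ M" using st(1) s' ys(2) unfolding is_struct_def by blast
      ultimately show "fn N' s xs \<in> f ` univ M" by blast
    qed
  qed
  then have iso: "\<forall>M N N' f. substruct \<tau> M N \<and> isomorphism \<tau> f N N' \<longrightarrow>
      substruct \<tau> (induced \<tau> N' (f ` univ M)) N'" by blast
  show ?thesis
    unfolding abstract_class_def all_structs_sel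
  proof (intro conjI)
    show "\<forall>M N. substruct \<tau> M N \<longrightarrow> M \<in> {M. is_struct \<tau> M} \<and> N \<in> {M. is_struct \<tau> M} \<and> substruct \<tau> M N"
      by (simp add: substruct_iff)
    show "\<forall>M N. substruct \<tau> M N \<and> substruct \<tau> N M \<longrightarrow> M = N"
      by (intro allI impI) (elim conjE, rule substruct_antisym)
    show "\<forall>M N P. substruct \<tau> M N \<and> substruct \<tau> N P \<longrightarrow> substruct \<tau> M P"
      by (intro allI impI) (elim conjE, rule substruct_trans)
    show "\<forall>M N f. M \<in> {M. is_struct \<tau> M} \<and> isomorphism \<tau> f M N \<longrightarrow> N \<in> {M. is_struct \<tau> M}"
      by (simp add: isomorphism_def)
    show "\<forall>M\<in>{M. is_struct \<tau> M}. substruct \<tau> M M"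
      by (intro ballI substruct_refl) simp
  qed (use assms iso in simp_all)
qed

primrec tm_subst :: "('x \<Rightarrow> ('o, 'y) tm) \<Rightarrow> ('o, 'x) tm \<Rightarrow> ('o, 'y) tm" where
  "tm_subst \<sigma> (Var x) = \<sigma> x"
| "tm_subst \<sigma> (App s ts) = App s (map (tm_subst \<sigma>) ts)"

primrec atm_subst :: "('x \<Rightarrow> ('o, 'y) tm) \<Rightarrow> ('o, 'x) atm \<Rightarrow> ('o, 'y) atm" where
  "atm_subst \<sigma> (Eq t u) = Eq (tm_subst \<sigma> t) (tm_subst \<sigma> u)"
| "atm_subst \<sigma> (Rel s ts) = Rel s (map (tm_subst \<sigma>) ts)"

lemma tm_val_subst: "tm_val M v (tm_subst \<sigma> t) = tm_val M (\<lambda>x. tm_val M v (\<sigma> x)) t"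
  by (induction t) (simp_all add: comp_def cong: map_cong)

lemma sat_subst: "sat M v (atm_subst \<sigma> \<phi>) \<longleftrightarrow> sat M (\<lambda>x. tm_val M v (\<sigma> x)) \<phi>"
  by (cases \<phi>) (simp_all add: tm_val_subst comp_def)

lemma wf_tm_subst:
  "wf_tm \<tau> t \<Longrightarrow> (\<And>x. x \<in> tvars t \<Longrightarrow> wf_tm \<tau> (\<sigma> x)) \<Longrightarrow> wf_tm \<tau> (tm_subst \<sigma> t)"
  by (induction t) (auto simp: list_all_iff)

lemma wf_atm_subst:
  "wf_atm \<tau> \<phi> \<Longrightarrow> (\<And>x. x \<in> avars \<phi> \<Longrightarrow> wf_tm \<tau> (\<sigma> x)) \<Longrightarrow> wf_atm \<tau> (atm_subst \<sigma> \<phi>)"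
  by (cases \<phi>) (fastforce simp: list_all_iff intro!: wf_tm_subst)+

lemma tvars_subst: "tvars (tm_subst \<sigma> t) = (\<Union>x\<in>tvars t. tvars (\<sigma> x))"
  by (induction t) auto

lemma avars_subst: "avars (atm_subst \<sigma> \<phi>) = (\<Union>x\<in>avars \<phi>. tvars (\<sigma> x))"
  by (cases \<phi>) (auto simp: tvars_subst)

text \<open>
  The values of terms at \<open>a\<close> form the substructure \<open>G\<close> of \<open>M\<close> generated by \<open>a\<close>.  Sending the value of
  a term at \<open>a\<close> to its value at \<open>b\<close> is well defined and injective because the diagrams contain the
  same equations, and it embeds \<open>G\<close> in \<open>N\<close> by substitution of terms in atoms.  Both \<open>(a, M)\<close> and
  \<open>(b, N)\<close> are thereby linked to \<open>(a, G)\<close>.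
\<close>
lemma same_diagram_imp_same_type:
  assumes \<tau>: "language \<tau>" and M: "is_struct \<tau> M" "set a \<subseteq> univ M"
    and N: "is_struct \<tau> N" "set b \<subseteq> univ N" and len: "length a = length b"
    and diag: "\<And>\<phi>. wf_atm \<tau> \<phi> \<Longrightarrow> avars \<phi> \<subseteq> {..<length a} \<Longrightarrow> sat M (nth a) \<phi> \<longleftrightarrow> sat N (nth b) \<phi>"
  shows "same_type (all_structs \<tau>) a M b N"
proof -
  define T :: "('a, nat) tm set" where "T = {t. wf_tm \<tau> t \<and> tvars t \<subseteq> {..<length a}}"
  define gen where "gen = (\<lambda>P c. tm_val P (nth c) ` T)"
  have gen_sub: "substruct \<tau> (induced \<tau> P (gen P c)) P"
    if P: "is_struct \<tau> P" "set c \<subseteq> univ P" "length c = length a" for P c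
  proof (rule substruct_induced[OF P(1)])
    have "tm_val P (nth c) t \<in> univ P" if "t \<in> T" for t
    proof -
      have "nth c ` tvars t \<subseteq> set c" using that P(3) by (auto simp: T_def intro!: nth_mem)
      then have "nth c ` tvars t \<subseteq> univ P" using P(2) by blast
      moreover have "wf_tm \<tau> t" using that by (simp add: T_def)
      ultimately show ?thesis using tm_val_substruct[OF substruct_refl[OF P(1)]] by blast
    qed
    then show "gen P c \<subseteq> univ P" by (auto simp: gen_def)
    fix s xs assume s: "(s, length xs) \<in> Fsym \<tau>" and xs: "set xs \<subseteq> gen P c"
    then have "xs \<in> lists (tm_val P (nth c) ` T)" by (auto simp: gen_def)
    then obtain ts where ts: "xs = map (tm_val P (nth c)) ts" "set ts \<subseteq> T"
      unfolding lists_image by auto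
    then have "App s ts \<in> T" using s by (auto simp: T_def list_all_iff)
    then show "fn P s xs \<in> gen P c" using ts by (force simp: gen_def)
  qed
  have gen_self: "set c \<subseteq> gen P c" if "length c = length a" for P c
  proof
    fix x assume "x \<in> set c"
    then obtain i where "i < length c" "x = c ! i" by (metis in_set_conv_nth)
    then show "x \<in> gen P c" unfolding gen_def
      using that by (intro image_eqI[of _ _ "Var i"]) (auto simp: T_def)
  qed
  (* g moves the value of a term at a to its value at b. *)
  define g where "g y = tm_val N (nth b) (SOME t. t \<in> T \<and> tm_val M (nth a) t = y)" for y
  have eq: "tm_val M (nth a) t = tm_val M (nth a) u \<longleftrightarrow> tm_val N (nth b) t = tm_val N (nth b) u"
    if "t \<in> T" "u \<in> T" for t u
    using diag[of "Eq t u"] that by (simp add: T_def)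
  have g: "g (tm_val M (nth a) t) = tm_val N (nth b) t" if "t \<in> T" for t
  proof -
    have "\<exists>u. u \<in> T \<and> tm_val M (nth a) u = tm_val M (nth a) t" using that by blast
    from someI_ex[OF this] show ?thesis using eq that unfolding g_def by blast
  qed
  let ?G = "induced \<tau> M (gen M a)"
  have G: "substruct \<tau> ?G M" using gen_sub[OF M] by simp
  have img: "g ` gen M a = gen N b" using g by (force simp: gen_def)
  have H: "substruct \<tau> (induced \<tau> N (gen N b)) N" using gen_sub[OF N] len by simp
  have "sat ?G v \<phi> \<longleftrightarrow> sat N (g \<circ> v) \<phi>"
    if \<phi>: "wf_atm \<tau> (\<phi> :: ('a, nat) atm)" and v: "v ` avars \<phi> \<subseteq> gen M a" for \<phi> v
  proof -
    have "\<forall>x. \<exists>t. x \<in> avars \<phi> \<longrightarrow> t \<in> T \<and> v x = tm_val M (nth a) t"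
      using v by (auto simp: gen_def image_subset_iff image_iff)
    then obtain \<sigma> where \<sigma>: "\<And>x. x \<in> avars \<phi> \<Longrightarrow> \<sigma> x \<in> T \<and> v x = tm_val M (nth a) (\<sigma> x)"
      by metis
    have "sat ?G v \<phi> \<longleftrightarrow> sat M v \<phi>" using sat_substruct[OF G \<phi>] v by simp
    also have "\<dots> \<longleftrightarrow> sat M (nth a) (atm_subst \<sigma> \<phi>)"
      unfolding sat_subst using \<sigma> by (intro sat_cong) blast
    also have "\<dots> \<longleftrightarrow> sat N (nth b) (atm_subst \<sigma> \<phi>)"
    proof (rule diag)
      show "wf_atm \<tau> (atm_subst \<sigma> \<phi>)" using \<sigma> by (intro wf_atm_subst[OF \<phi>]) (simp add: T_def)
      show "avars (atm_subst \<sigma> \<phi>) \<subseteq> {..<length a}"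
        unfolding avars_subst using \<sigma> by (auto simp: T_def)
    qed
    also have "\<dots> \<longleftrightarrow> sat N (g \<circ> v) \<phi>"
      unfolding sat_subst using \<sigma> g by (intro sat_cong) simp
    finally show ?thesis .
  qed
  moreover have "inj_on g (gen M a)"
    using g eq by (auto simp: inj_on_def gen_def)
  moreover have "gen N b \<subseteq> univ N" using H by (simp add: substruct_def)
  ultimately have "embedding \<tau> g ?G N" using img unfolding embedding_def by simp
  then have gemb: "K_embedding (all_structs \<tau>) g ?G N"
    using G H N(1) img unfolding K_embedding_def all_structs_def by (simp add: substruct_def)
  have b: "b = map g a"
  proof (rule nth_equalityI)
    fix i assume "i < length b"
    then show "b ! i = map g a ! i" using g[of "Var i"] len by (simp add: T_def)
  qed (simp add: len)
  have K: "abstract_class (all_structs \<tau>)" using abstract_class_all_structs[OF \<tau>] .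
  have "type_step (all_structs \<tau>) (b, N) (a, ?G)"
    unfolding type_step_def using gemb b N G substruct_refl[OF N(1)] gen_self[of a M]
    by (auto simp: all_structs_def substruct_def)
  moreover have "type_step (all_structs \<tau>) (a, ?G) (a, M)"
  proof -
    have "K_embedding (all_structs \<tau>) (\<lambda>x. x) M M"
      using K_embedding_Le[OF K, of M M] substruct_refl[OF M(1)] by simp
    then have "\<exists>P f. substruct \<tau> ?G P \<and> K_embedding (all_structs \<tau>) f M P \<and> a = map f a"
      using G by (intro exI[of _ M] exI[of _ "\<lambda>x. x"]) simp
    then show ?thesis
      unfolding type_step_def using M gen_self[of a M] G by (simp add: substruct_iff)
  qed
  ultimately have "same_type (all_structs \<tau>) b N a M"
    using same_type_step same_type_trans by blast
  then show ?thesis by (rule same_type_sym[OF K])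
qed

text \<open>
  Induction on the size of terms: those of size at most \<open>d\<close> are variables or symbols applied to lists
  of terms of smaller size.
\<close>
lemma wf_tms_lepoll:
  fixes C :: "'c set" and \<tau> :: "'o lang"
  assumes C: "infinite C" and F: "Fsym \<tau> \<lesssim> C"
  shows "{t :: ('o, nat) tm. wf_tm \<tau> t} \<lesssim> C"
proof -
  have nat: "(UNIV :: nat set) \<lesssim> C" using C infinite_le_lepoll by blast
  have size: "{t :: ('o, nat) tm. wf_tm \<tau> t \<and> size t < d} \<lesssim> C" for d
  proof (induction d)
    case (Suc d)
    let ?T = "{t :: ('o, nat) tm. wf_tm \<tau> t \<and> size t < d}"
    have "{t :: ('o, nat) tm. wf_tm \<tau> t \<and> size t < Suc d} \<subseteq>
        (\<Union>x. {Var x}) \<union> (\<Union>p\<in>Fsym \<tau>. App (fst p) ` {ts. length ts = snd p \<and> set ts \<subseteq> ?T})"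
    proof
      fix t :: "('o, nat) tm" assume t: "t \<in> {t. wf_tm \<tau> t \<and> size t < Suc d}"
      show "t \<in> (\<Union>x. {Var x}) \<union> (\<Union>p\<in>Fsym \<tau>. App (fst p) ` {ts. length ts = snd p \<and> set ts \<subseteq> ?T})"
      proof (cases t)
        case (App s ts)
        have "size u < d" if "u \<in> set ts" for u
          using t App size_list_estimation'[of u ts "size u" size] that by auto
        then have "set ts \<subseteq> ?T" using t App by (auto simp: list_all_iff)
        then show ?thesis using t App by (intro UnI2 UN_I[of "(s, length ts)"]) auto
      qed simp
    qed
    moreover have "\<dots> \<lesssim> C"
    proof -
      have one: "{Var x} \<lesssim> C" for x :: nat
        using C by (intro finite_lepoll_infinite) auto
      have app: "App (fst p) ` {ts. length ts = snd p \<and> set ts \<subseteq> ?T} \<lesssim> C" for p :: "'o \<times> nat"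
        using lists_of_length_lepoll_infinite[OF C Suc.IH] image_lepoll lepoll_trans by blast
      show ?thesis
        by (rule Un_lepoll_infinite[OF C UNION_lepoll_infinite[OF C nat one]
              UNION_lepoll_infinite[OF C F app]])
    qed
    ultimately show ?case using lepoll_trans[OF subset_imp_lepoll] by blast
  qed simp
  have "{t :: ('o, nat) tm. wf_tm \<tau> t} = (\<Union>d. {t. wf_tm \<tau> t \<and> size t < d})" by auto
  then show ?thesis using UNION_lepoll_infinite[OF C nat size] by simp
qed

lemma wf_atms_lepoll:
  fixes C :: "'c set" and \<tau> :: "'o lang"
  assumes C: "infinite C" and \<tau>: "Fsym \<tau> <+> Rsym \<tau> \<lesssim> C"
  shows "{\<phi> :: ('o, nat) atm. wf_atm \<tau> \<phi>} \<lesssim> C"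
proof -
  have F: "Fsym \<tau> \<lesssim> C" and R: "Rsym \<tau> \<lesssim> C"
    using \<tau> by (meson lepoll_trans lepoll_iff_leqpoll subset_imp_lepoll lepoll_def inj_Inl inj_Inr
      inj_on_subset subset_UNIV image_subset_iff InlI InrI)+
  let ?T = "{t :: ('o, nat) tm. wf_tm \<tau> t}"
  have T: "?T \<lesssim> C" by (rule wf_tms_lepoll[OF C F])
  let ?E = "(\<lambda>(t, u). Eq t u) ` (?T \<times> ?T)"
  let ?R = "\<Union>p\<in>Rsym \<tau>. Rel (fst p) ` {ts. length ts = snd p \<and> set ts \<subseteq> ?T}"
  have "{\<phi> :: ('o, nat) atm. wf_atm \<tau> \<phi>} \<subseteq> ?E \<union> ?R"
  proof
    fix \<phi> :: "('o, nat) atm" assume "\<phi> \<in> {\<phi>. wf_atm \<tau> \<phi>}"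
    then show "\<phi> \<in> ?E \<union> ?R"
      by (cases \<phi>) (force simp: list_all_iff)+
  qed
  moreover have "?E \<lesssim> C" using times_lepoll_infinite[OF C T T] image_lepoll lepoll_trans by blast
  moreover have "?R \<lesssim> C"
  proof (rule UNION_lepoll_infinite[OF C R])
    fix p
    show "Rel (fst p) ` {ts. length ts = snd p \<and> set ts \<subseteq> ?T} \<lesssim> C"
      using lists_of_length_lepoll_infinite[OF C T] image_lepoll lepoll_trans by blast
  qed
  ultimately have "?E \<union> ?R \<lesssim> C" by (intro Un_lepoll_infinite[OF C])
  then show ?thesis
    using \<open>{\<phi>. wf_atm \<tau> \<phi>} \<subseteq> ?E \<union> ?R\<close> lepoll_trans[OF subset_imp_lepoll] by blast
qed

text \<open>
  The atomic diagram of a representative determines the type.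
\<close>
lemma types_all_structs_lepoll:
  fixes \<tau> :: "'o lang"
  assumes \<tau>: "language \<tau>" and C: "infinite C" "Fsym \<tau> <+> Rsym \<tau> \<lesssim> C"
  shows "types (all_structs \<tau>) n \<lesssim> Pow C"
proof -
  define W where "W = {\<phi> :: ('o, nat) atm. wf_atm \<tau> \<phi>}"
  define D where "D = (\<lambda>(a, M). {\<phi>\<in>W. avars \<phi> \<subseteq> {..<n} \<and> sat M (nth a) \<phi>})"
  have "\<forall>p. \<exists>x. p \<in> types (all_structs \<tau>) n \<longrightarrow>
      p = tp (all_structs \<tau>) (fst x) (snd x) \<and> is_struct \<tau> (snd x) \<and>
      set (fst x) \<subseteq> univ (snd x) \<and> length (fst x) = n"
    by (auto simp: types_def all_structs_def)
  then obtain r where r: "\<And>p. p \<in> types (all_structs \<tau>) n \<Longrightarrow>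
      p = tp (all_structs \<tau>) (fst (r p)) (snd (r p)) \<and> is_struct \<tau> (snd (r p)) \<and>
      set (fst (r p)) \<subseteq> univ (snd (r p)) \<and> length (fst (r p)) = n"
    by metis
  have "inj_on (D \<circ> r) (types (all_structs \<tau>) n)"
  proof (rule inj_onI)
    fix p q assume p: "p \<in> types (all_structs \<tau>) n" and q: "q \<in> types (all_structs \<tau>) n"
      and eq: "(D \<circ> r) p = (D \<circ> r) q"
    have "same_type (all_structs \<tau>) (fst (r p)) (snd (r p)) (fst (r q)) (snd (r q))"
      using r[OF p] r[OF q] eq
      by (intro same_diagram_imp_same_type[OF \<tau>]) (auto simp: D_def W_def case_prod_unfold set_eq_iff)
    then show "p = q"
      using r[OF p] r[OF q] tp_eq_iff[OF abstract_class_all_structs[OF \<tau>]] same_type_memD by metis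
  qed
  moreover have "(D \<circ> r) ` types (all_structs \<tau>) n \<subseteq> Pow W" by (auto simp: D_def)
  ultimately have "types (all_structs \<tau>) n \<lesssim> Pow W" unfolding lepoll_def by blast
  then show ?thesis
    using Pow_lepoll_mono[OF wf_atms_lepoll[OF C]] lepoll_trans unfolding W_def by blast
qed


section \<open>Increasing tuples and big structures\<close>

lemma sorted_wrt_nths: "sorted_wrt P xs \<Longrightarrow> sorted_wrt P (nths xs s)"
  by (induction xs arbitrary: s) (auto simp: nths_Cons dest: in_set_nthsD)

lemma sorted_wrt_irrefl_distinct:
  "sorted_wrt P xs \<Longrightarrow> (\<And>x. x \<in> set xs \<Longrightarrow> \<not> P x x) \<Longrightarrow> distinct xs"
  by (induction xs) auto

lemma sorted_wrt_unique:
  assumes irr: "\<And>x. x \<in> A \<Longrightarrow> \<not> P x x"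
    and tr: "\<And>x y z. x \<in> A \<Longrightarrow> y \<in> A \<Longrightarrow> z \<in> A \<Longrightarrow> P x y \<Longrightarrow> P y z \<Longrightarrow> P x z"
  shows "sorted_wrt P xs \<Longrightarrow> sorted_wrt P ys \<Longrightarrow> set xs = set ys \<Longrightarrow> set xs \<subseteq> A \<Longrightarrow> xs = ys"
proof (induction xs arbitrary: ys)
  case (Cons x xs)
  then obtain y ys' where ys: "ys = y # ys'" by (cases ys) auto
  have A: "x \<in> A" "y \<in> A" using Cons.prems ys by auto
  have "x = y"
  proof (rule ccontr)
    assume "x \<noteq> y"
    then have "P x y" "P y x" using Cons.prems ys by auto
    then show False using irr tr A by blast
  qed
  moreover have "x \<notin> set xs" "y \<notin> set ys'" using irr A Cons.prems ys by auto
  ultimately have "set xs = set ys'" using Cons.prems(3) ys insert_ident[of x "set xs" "set ys'"] by simp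
  then show ?case using Cons.IH[of ys'] Cons.prems ys \<open>x = y\<close> by simp
qed simp

locale class_with_bigness =
  fixes K :: "'o::wellorder aclass" and lt :: 'o and big :: "'o \<Rightarrow> 'o structr set"
  assumes inacc: "inaccessible TYPE('o)"
    and ordered: "ordered_abstract_class K lt"
    and bigness: "bigness K big"
begin

lemma abstract: "abstract_class K"
  using ordered by (simp add: ordered_abstract_class_def)

lemma big_mem: "is_card \<mu> \<Longrightarrow> I \<in> big \<mu> \<Longrightarrow> I \<in> Mem K"
  using bigness unfolding bigness_def by blast

lemma big_mono:
  "is_card \<mu> \<Longrightarrow> is_card \<nu> \<Longrightarrow> \<mu> \<le> \<nu> \<Longrightarrow> Le K I J \<Longrightarrow> I \<in> big \<nu> \<Longrightarrow> J \<in> big \<mu>"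
  using bigness unfolding bigness_def by blast

lemma big_antimono: "is_card \<mu> \<Longrightarrow> is_card \<nu> \<Longrightarrow> \<mu> \<le> \<nu> \<Longrightarrow> I \<in> big \<nu> \<Longrightarrow> I \<in> big \<mu>"
  using big_mono big_mem abstract_classD(5)[OF abstract] by blast

lemma increasing_Le:
  assumes "Le K I J" "increasing lt I a"
  shows "increasing lt J a"
proof -
  have IJ: "univ I \<subseteq> univ J" and rl: "\<And>xs. set xs \<subseteq> univ I \<Longrightarrow> rl I lt xs = rl J lt xs"
    using abstract_classD(4)[OF abstract assms(1)] unfolding substruct_iff by simp_all
  have a: "set a \<subseteq> univ I" "sorted_wrt (\<lambda>x y. rl I lt [x, y]) a"
    using assms(2) by (simp_all add: increasing_def)
  from a(2) have "sorted_wrt (\<lambda>x y. rl J lt [x, y]) a"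
  proof (rule sorted_wrt_mono_rel[rotated])
    fix x y assume "x \<in> set a" "y \<in> set a" "rl I lt [x, y]"
    moreover have "set [x, y] \<subseteq> univ I" using calculation(1,2) a(1) by auto
    ultimately show "rl J lt [x, y]" using rl by blast
  qed
  then show ?thesis using a(1) IJ unfolding increasing_def by blast
qed

lemma increasing_same_type:
  assumes st: "same_type K a I b J" and a: "increasing lt I a"
  shows "increasing lt J b"
proof -
  have len: "length a = length b" using same_type_length[OF st] .
  have "rl J lt [b ! i, b ! j]" if "i < j" "j < length b" for i j
  proof -
    let ?\<phi> = "Rel lt [Var i, Var j] :: ('o, nat) atm"
    have "wf_atm (Lang K) ?\<phi>" using ordered by (simp add: ordered_abstract_class_def numeral_2_eq_2)
    then have "sat I (nth a) ?\<phi> \<longleftrightarrow> sat J (nth b) ?\<phi>"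
      by (rule same_type_sat[OF abstract st]) (use that len in simp)
    then show ?thesis
      using a that len by (simp add: increasing_def sorted_wrt_iff_nth_less)
  qed
  then show ?thesis
    using same_type_memD[OF st] by (simp add: increasing_def sorted_wrt_iff_nth_less)
qed

lemma lt_irrefl:
  assumes "I \<in> Mem K" "x \<in> univ I"
  shows "\<not> rl I lt [x, x]"
proof -
  note o = bspec[OF conjunct2[OF conjunct2[OF ordered[unfolded ordered_abstract_class_def]]] assms(1)]
  show ?thesis using bspec[OF conjunct1[OF o] assms(2)] .
qed

lemma lt_trans:
  assumes "I \<in> Mem K" and xyz: "x \<in> univ I" "y \<in> univ I" "z \<in> univ I"
    and rl: "rl I lt [x, y]" "rl I lt [y, z]"
  shows "rl I lt [x, z]"
proof -
  note o = bspec[OF conjunct2[OF conjunct2[OF ordered[unfolded ordered_abstract_class_def]]] assms(1)]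
  show ?thesis
    using bspec[OF bspec[OF bspec[OF conjunct1[OF conjunct2[OF o]] xyz(1)] xyz(2)] xyz(3)] rl by blast
qed

text \<open>
  An increasing tuple is the enumeration of its range, so that a colouring of finite sets and a
  labelling of increasing tuples carry the same information.
\<close>
lemma increasing_unique:
  assumes "I \<in> Mem K" "increasing lt I a" "increasing lt I b" "set a = set b"
  shows "a = b"
proof (rule sorted_wrt_unique[of "univ I" "\<lambda>x y. rl I lt [x, y]"])
  show "\<not> rl I lt [x, x]" if "x \<in> univ I" for x
    using lt_irrefl[OF assms(1) that] .
  show "rl I lt [x, z]" if "x \<in> univ I" "y \<in> univ I" "z \<in> univ I" "rl I lt [x, y]" "rl I lt [y, z]" for x y z
    using lt_trans[OF assms(1) that] .
qed (use assms in \<open>simp_all add: increasing_def\<close>)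

lemma increasing_nsets:
  assumes "I \<in> Mem K" "increasing lt I a"
  shows "set a \<in> nsets (univ I) (length a)"
proof -
  have a: "set a \<subseteq> univ I" "sorted_wrt (\<lambda>x y. rl I lt [x, y]) a"
    using assms(2) by (simp_all add: increasing_def)
  have "distinct a"
    using a(1) lt_irrefl[OF assms(1)] by (intro sorted_wrt_irrefl_distinct[OF a(2)]) blast
  then show ?thesis using a(1) by (simp add: nsets_def distinct_card)
qed

lemma increasing_nths: "increasing lt I a \<Longrightarrow> increasing lt I (nths a s)"
  by (auto simp: increasing_def intro!: sorted_wrt_nths dest: in_set_nthsD)

lemma tp_in_inc_types:
  "I \<in> Mem K \<Longrightarrow> increasing lt I a \<Longrightarrow> tp K a I \<in> inc_types K lt (length a)"
  unfolding inc_types_def by blast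

lemma inc_types_subset_types: "inc_types K lt n \<subseteq> types K n"
  unfolding inc_types_def types_def increasing_def by blast

lemma inc_typesD:
  assumes "tp K a I \<in> inc_types K lt n" "I \<in> Mem K" "set a \<subseteq> univ I"
  shows "increasing lt I a" "length a = n"
proof -
  obtain b J where b: "tp K a I = tp K b J" "J \<in> Mem K" "increasing lt J b" "length b = n"
    using assms(1) unfolding inc_types_def by blast
  then have sub: "set b \<subseteq> univ J" by (simp add: increasing_def)
  have st: "same_type K b J a I"
    using iffD1[OF tp_eq_iff[OF abstract b(2) sub assms(2,3)] b(1)[symmetric]] .
  show "increasing lt I a" using increasing_same_type[OF st b(3)] .
  show "length a = n" using same_type_length[OF st] b(4) by simp
qed

lemma inc_types_disjoint:
  assumes "p \<in> inc_types K lt n" "p \<in> inc_types K lt m"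
  shows "n = m"
proof -
  obtain a I where "p = tp K a I" "I \<in> Mem K" "increasing lt I a" "length a = n"
    using assms(1) unfolding inc_types_def by blast
  then show ?thesis using inc_typesD(2)[of a I m] assms(2) by (simp add: increasing_def)
qed

lemma types_realised:
  assumes \<mu>: "is_card \<mu>" "aleph0 \<le> \<mu>" "I \<in> big \<mu>" and p: "p \<in> types K n"
  shows "\<exists>a. set a \<subseteq> univ I \<and> tp K a I = p"
proof -
  have "is_card (aleph0 :: 'o)" using infinite_card_aleph0[OF inacc] infinite_card_def by blast
  then have "I \<in> big aleph0" using big_antimono \<mu> by blast
  then show ?thesis using bigness p unfolding bigness_def by blast
qed

lemma inc_types_realised:
  assumes \<mu>: "is_card \<mu>" "aleph0 \<le> \<mu>" "I \<in> big \<mu>" and p: "p \<in> inc_types K lt n"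
  shows "\<exists>a. increasing lt I a \<and> length a = n \<and> tp K a I = p"
  using types_realised[OF \<mu>] p inc_types_subset_types inc_typesD big_mem[OF \<mu>(1,3)] by blast

lemma exists_big_aleph0: "\<exists>I. I \<in> big aleph0 \<and> I \<in> Mem K"
proof -
  have "is_card (aleph0 :: 'o)" using infinite_card_aleph0[OF inacc] infinite_card_def by blast
  then show ?thesis using bigness big_mem unfolding bigness_def by blast
qed

text \<open>
  The members of the class may form a proper class, but a single \<open>\<aleph>\<^sub>0\<close>-big structure
  realises all types, so that there are no more types than tuples in that structure.
\<close>
lemma small_types: "types K n \<prec> (UNIV :: 'o set)"
proof -
  obtain I where I: "I \<in> big aleph0" "I \<in> Mem K" using exists_big_aleph0 by blast
  have c: "is_card (aleph0 :: 'o)" using infinite_card_aleph0[OF inacc] infinite_card_def by blast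
  have "types K n \<subseteq> (\<lambda>a. tp K a I) ` {a. length a = n \<and> set a \<subseteq> univ I}"
  proof
    fix p assume p: "p \<in> types K n"
    then obtain b J where b: "p = tp K b J" "J \<in> Mem K" "set b \<subseteq> univ J" "length b = n"
      unfolding types_def by blast
    obtain a where a: "set a \<subseteq> univ I" "tp K a I = p" using types_realised[OF c _ I(1) p] by auto
    then have "length a = n"
      using tp_eq_iff[OF abstract I(2) a(1) b(2,3)] b same_type_length by auto
    then show "p \<in> (\<lambda>a. tp K a I) ` {a. length a = n \<and> set a \<subseteq> univ I}" using a by blast
  qed
  moreover have "univ I \<prec> (UNIV :: 'o set)"
    using abstract_classD(1)[OF abstract I(2)] unfolding is_struct_def by blast
  ultimately show ?thesis
    by (rule lesspoll_trans1[OF subset_image_lepoll small_lists_of_length[OF inacc]])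
qed

lemma types_0_nonempty: "types K 0 \<noteq> {}"
proof -
  obtain I where "I \<in> Mem K" using exists_big_aleph0 by blast
  then have "tp K [] I \<in> types K 0" unfolding types_def by fastforce
  then show ?thesis by blast
qed


section \<open>From strong properties to partition relations\<close>

text \<open>
  For a constant family it does not matter which of the cofinally many \<open>\<beta>\<close> is provided.
\<close>
lemma strongly_ER_if_strongly_cofinally_ER:
  assumes \<chi>: "is_card \<chi>" and ER: "strongly_cofinally_ER K lt big \<mu> \<chi>"
  shows "strongly_ER K lt big \<mu> \<chi>"
  unfolding strongly_ER_def
proof (intro ballI allI impI, elim conjE)
  fix I \<tau> M f
  assume I: "I \<in> big \<chi>" and "language \<tau>" "lang_card_le \<tau> \<mu>" "is_struct \<tau> M"
    "inj_on f (univ I)" "f ` univ I \<subseteq> univ M"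
  moreover have "I \<in> big \<alpha>" if "is_card \<alpha>" "\<alpha> < \<chi>" for \<alpha>
    using big_antimono[OF that(1) \<chi> _ I] that(2) by simp
  ultimately have "language \<tau> \<and> lang_card_le \<tau> \<mu> \<and> (\<forall>\<alpha>. is_card \<alpha> \<and> \<alpha> < \<chi> \<longrightarrow>
      is_struct \<tau> M \<and> I \<in> big \<alpha> \<and> inj_on f (univ I) \<and> f ` univ I \<subseteq> univ M)"
    by simp
  from ER[unfolded strongly_cofinally_ER_def, THEN spec[of _ \<tau>], THEN spec[of _ "\<lambda>_. M"],
      THEN spec[of _ "\<lambda>_. I"], THEN spec[of _ "\<lambda>_. f"], THEN mp, OF this]
  obtain \<Phi> where \<Phi>: "blueprint K lt \<tau> \<Phi>"
    and hom: "\<forall>\<alpha> n. is_card \<alpha> \<and> \<alpha> < \<chi> \<longrightarrow> (\<forall>\<gamma>. is_card \<gamma> \<and> \<gamma> < \<chi> \<longrightarrow>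
      (\<exists>\<beta>. is_card \<beta> \<and> \<gamma> \<le> \<beta> \<and> \<beta> < \<chi> \<and>
      (\<exists>I'\<in>big \<alpha>. Le K I' I \<and> (\<forall>a. increasing lt I' a \<and> length a = n \<longrightarrow>
         tp (all_structs \<tau>) (map f a) M = \<Phi> (tp K a I)))))"
    by (elim exE conjE) rule
  have "\<exists>I'\<in>big \<alpha>. Le K I' I \<and> (\<forall>a. increasing lt I' a \<and> length a = n \<longrightarrow>
      tp (all_structs \<tau>) (map f a) M = \<Phi> (tp K a I))" if "is_card \<alpha> \<and> \<alpha> < \<chi>" for \<alpha> n
    using hom[THEN spec[of _ \<alpha>], THEN spec[of _ n], THEN mp, OF that, THEN spec[of _ \<alpha>], THEN mp, OF that]
    by (elim exE conjE)
  then show "\<exists>\<Phi>. blueprint K lt \<tau> \<Phi> \<and>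
      (\<forall>\<alpha> n. is_card \<alpha> \<and> \<alpha> < \<chi> \<longrightarrow> (\<exists>I'\<in>big \<alpha>. Le K I' I \<and>
         (\<forall>a. increasing lt I' a \<and> length a = n \<longrightarrow>
            tp (all_structs \<tau>) (map f a) M = \<Phi> (tp K a I))))"
    using \<Phi> by (intro exI[of _ \<Phi>]) simp
qed

text \<open>
  Equip \<open>univ I\<close> with relations \<open>R\<^sub>s\<close> that hold of the tuples whose range has colour \<open>s\<close>.  On the
  structure provided by the strong property, tuples of equal type in \<open>K\<close> have equal quantifier-free
  type, hence satisfy the same \<open>R\<^sub>s\<close>.
\<close>
lemma arrows_if_strongly_ER:
  assumes \<mu>: "{..<\<mu>} \<noteq> {}" and \<chi>: "is_card \<chi>" and ER: "strongly_ER K lt big \<mu> \<chi>"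
    and \<theta>: "is_card \<theta>" "\<theta> < \<chi>"
  shows "arrows K lt big \<chi> \<theta> n \<mu>"
  unfolding arrows_def
proof (intro ballI allI impI)
  fix I c assume I: "I \<in> big \<chi>" and c: "c ` nsets (univ I) n \<subseteq> {..<\<mu>}"
  define \<tau> :: "'o lang" where "\<tau> = \<lparr>Fsym = {}, Rsym = {..<\<mu>} \<times> {n}\<rparr>"
  define M :: "'o structr" where "M = \<lparr>univ = univ I, fn = (\<lambda>s xs. undefined),
    rl = (\<lambda>s xs. s < \<mu> \<and> length xs = n \<and> set xs \<subseteq> univ I \<and> c (set xs) = s)\<rparr>"
  have IK: "I \<in> Mem K" using big_mem[OF \<chi> I] .
  have le: "Fsym \<tau> <+> Rsym \<tau> \<lesssim> {..<\<mu>}"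
  proof -
    have "Fsym \<tau> <+> Rsym \<tau> = (\<lambda>s. Inr (s, n)) ` {..<\<mu>}" by (auto simp: \<tau>_def)
    then show ?thesis using image_lepoll by metis
  qed
  have \<tau>: "language \<tau>"
    unfolding language_def by (rule lesspoll_trans1[OF le small_initial_segment[OF inacc]])
  have M: "is_struct \<tau> M"
    using abstract_classD(1)[OF abstract IK] unfolding is_struct_def M_def \<tau>_def by auto
  have "inj_on (\<lambda>x. x) (univ I)" "(\<lambda>x. x) ` univ I \<subseteq> univ M" by (simp_all add: M_def)
  then have "language \<tau> \<and> lang_card_le \<tau> \<mu> \<and> is_struct \<tau> M \<and>
      inj_on (\<lambda>x. x) (univ I) \<and> (\<lambda>x. x) ` univ I \<subseteq> univ M"
    using \<tau> le M unfolding lang_card_le_def by (intro conjI)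
  from ER[unfolded strongly_ER_def, THEN bspec, OF I, THEN spec[of _ \<tau>], THEN spec[of _ M],
      THEN spec[of _ "\<lambda>x. x"], THEN mp, OF this]
  obtain \<Phi> where "\<forall>\<alpha> n. is_card \<alpha> \<and> \<alpha> < \<chi> \<longrightarrow> (\<exists>I'\<in>big \<alpha>. Le K I' I \<and>
      (\<forall>a. increasing lt I' a \<and> length a = n \<longrightarrow>
         tp (all_structs \<tau>) (map (\<lambda>x. x) a) M = \<Phi> (tp K a I)))"
    by (elim exE conjE) rule
  from this[THEN spec[of _ \<theta>], THEN spec[of _ n], THEN mp, OF conjI[OF \<theta>]]
  obtain I' where I': "I' \<in> big \<theta>" "Le K I' I" and hom: "\<And>a. increasing lt I' a \<Longrightarrow> length a = n \<Longrightarrow>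
      tp (all_structs \<tau>) a M = \<Phi> (tp K a I)"
    by auto
  have inc: "increasing lt I a" if "increasing lt I' a" for a
    using increasing_Le[OF I'(2) that] .
  have col: "c (set a) < \<mu>" if "increasing lt I a" "length a = n" for a
    using increasing_nsets[OF IK that(1)] that(2) c by blast
  have same_colour: "c (set a) = c (set b)"
    if a: "increasing lt I' a" "length a = n" and b: "increasing lt I' b" "length b = n"
      and eq: "tp K a I = tp K b I" for a b
  proof -
    have sub: "set a \<subseteq> univ M" "set b \<subseteq> univ M"
      using inc[OF a(1)] inc[OF b(1)] by (simp_all add: increasing_def M_def)
    have "tp (all_structs \<tau>) a M = tp (all_structs \<tau>) b M"
      using hom[OF a] hom[OF b] eq by simp
    then have st: "same_type (all_structs \<tau>) a M b M"
      using tp_eq_iff[OF abstract_class_all_structs[OF \<tau>]] M sub by simp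
    (* This atom says that the tuple has the colour of a. *)
    let ?\<phi> = "Rel (c (set a)) (map Var [0..<n]) :: ('o, nat) atm"
    have "wf_atm (Lang (all_structs \<tau>)) ?\<phi>"
      using col[OF inc a(2)] a by (simp add: \<tau>_def list_all_iff)
    then have "sat M (nth a) ?\<phi> \<longleftrightarrow> sat M (nth b) ?\<phi>"
      by (rule same_type_sat[OF abstract_class_all_structs[OF \<tau>] st]) (auto simp: a)
    moreover have "map (tm_val M (nth a)) (map Var [0..<n]) = a"
      "map (tm_val M (nth b)) (map Var [0..<n]) = b"
      using map_nth[of a] map_nth[of b] a b by (simp_all add: comp_def)
    ultimately have "rl M (c (set a)) a \<longleftrightarrow> rl M (c (set a)) b" by (simp only: sat.simps)
    moreover have "rl M (c (set a)) a"
      using col[OF inc a(2)] a sub by (simp add: M_def)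
    ultimately show ?thesis by (simp add: M_def)
  qed
  obtain z where z: "z < \<mu>" using \<mu> by blast
  let ?P = "\<lambda>p a. increasing lt I' a \<and> length a = n \<and> tp K a I = p"
  (* The value z is only taken at types that no increasing tuple of I' realises. *)
  define c' where "c' p = (if \<exists>a. ?P p a then c (set (SOME a. ?P p a)) else z)" for p
  have c': "?P p (SOME a. ?P p a)" if "\<exists>a. ?P p a" for p
    using someI_ex[OF that] .
  have "c' ` inc_types K lt n \<subseteq> {..<\<mu>}"
    using c' col inc z unfolding c'_def by auto
  moreover have "c (set a) = c' (tp K a I)" if a: "increasing lt I' a" "length a = n" for a
  proof -
    have ex: "\<exists>b. ?P (tp K a I) b" using a by blast
    then have "c' (tp K a I) = c (set (SOME b. ?P (tp K a I) b))" by (simp add: c'_def)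
    moreover have "c (set a) = c (set (SOME b. ?P (tp K a I) b))"
      using c'[OF ex] by (intro same_colour[OF a]) simp_all
    ultimately show ?thesis by simp
  qed
  ultimately show "\<exists>I\<^sub>0\<in>big \<theta>. Le K I\<^sub>0 I \<and> type_homogeneous K lt \<mu> n I c I\<^sub>0"
    using I' unfolding type_homogeneous_def by blast
qed

text \<open>
  A colouring with few colours is one with many; the function on types may still take values outside
  \<open>\<kappa>\<close> at types that no increasing tuple of the substructure realises, and these are reset.
\<close>
lemma arrows_fewer_colours:
  assumes ar: "arrows K lt big \<chi> \<theta> n \<mu>" and \<kappa>: "\<kappa> \<le> \<mu>" "{..<\<kappa>} \<noteq> {}"
    and \<chi>: "is_card \<chi>"
  shows "arrows K lt big \<chi> \<theta> n \<kappa>"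
  unfolding arrows_def
proof (intro ballI allI impI)
  fix I c assume I: "I \<in> big \<chi>" and c: "c ` nsets (univ I) n \<subseteq> {..<\<kappa>}"
  have "c ` nsets (univ I) n \<subseteq> {..<\<mu>}" using c \<kappa>(1) by fastforce
  then obtain I' c' where I': "I' \<in> big \<theta>" "Le K I' I"
    and hom: "\<And>a. increasing lt I' a \<Longrightarrow> length a = n \<Longrightarrow> c (set a) = c' (tp K a I)"
    using ar I unfolding arrows_def type_homogeneous_def by metis
  obtain z where z: "z < \<kappa>" using \<kappa>(2) by blast
  have "c (set a) < \<kappa>" if "increasing lt I' a" "length a = n" for a
    using increasing_nsets[OF big_mem[OF \<chi> I] increasing_Le[OF I'(2) that(1)]] that(2) c by blast
  then have "\<forall>a. increasing lt I' a \<and> length a = n \<longrightarrow>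
      c (set a) = (if c' (tp K a I) < \<kappa> then c' (tp K a I) else z)"
    using hom by metis
  moreover have "(\<lambda>p. if c' p < \<kappa> then c' p else z) ` inc_types K lt n \<subseteq> {..<\<kappa>}" using z by auto
  ultimately show "\<exists>I\<^sub>0\<in>big \<theta>. Le K I\<^sub>0 I \<and> type_homogeneous K lt \<kappa> n I c I\<^sub>0"
    using I' unfolding type_homogeneous_def by blast
qed

text \<open>
  A colouring by no colours exists only if there are no increasing \<open>n\<close>-tuples; since big structures
  realise all types, there are then no increasing \<open>n\<close>-types either, and the whole structure is
  homogeneous for the empty function.
\<close>
lemma arrows_no_colours:
  assumes \<chi>: "is_card \<chi>" "aleph0 \<le> \<chi>" and \<theta>: "is_card \<theta>" "\<theta> \<le> \<chi>" and \<kappa>: "{..<\<kappa>} = {}"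
  shows "arrows K lt big \<chi> \<theta> n \<kappa>"
  unfolding arrows_def
proof (intro ballI allI impI)
  fix I c assume I: "I \<in> big \<chi>" and c: "c ` nsets (univ I) n \<subseteq> {..<\<kappa>}"
  have IK: "I \<in> Mem K" using big_mem[OF \<chi>(1) I] .
  have no: "\<not> (increasing lt I a \<and> length a = n)" for a
    using increasing_nsets[OF IK] c \<kappa> by blast
  then have "inc_types K lt n = {}" using inc_types_realised[OF \<chi> I] by blast
  then have "type_homogeneous K lt \<kappa> n I c I"
    using no unfolding type_homogeneous_def by (intro exI[of _ "\<lambda>_. undefined"]) auto
  then show "\<exists>I\<^sub>0\<in>big \<theta>. Le K I\<^sub>0 I \<and> type_homogeneous K lt \<kappa> n I c I\<^sub>0"
    using big_antimono[OF \<theta>(1) \<chi>(1) \<theta>(2) I] abstract_classD(5)[OF abstract IK] by blast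
qed

lemma combinatorially_ER_if_strongly_ER_by:
  assumes ER: "strongly_ER_by K lt big f"
    and f: "\<And>\<mu>. infinite_card \<mu> \<Longrightarrow> cardinal_suc \<mu> < f \<mu>"
  shows "\<exists>F. (\<forall>\<mu> n. infinite_card \<mu> \<longrightarrow> F (cardinal_suc \<mu>) n = f \<mu>) \<and> combinatorially_ER K lt big F"
proof -
  (* Any number of colours below mu is at most base mu: the predecessor if mu is the successor
     of an infinite cardinal, and otherwise the larger of aleph0 and mu. *)
  define base where "base \<mu> = (if \<exists>\<nu>. infinite_card \<nu> \<and> cardinal_suc \<nu> = \<mu>
      then SOME \<nu>. infinite_card \<nu> \<and> cardinal_suc \<nu> = \<mu> else max aleph0 \<mu>)" for \<mu> :: 'o
  have base_suc: "base (cardinal_suc \<nu>) = \<nu>" if "infinite_card \<nu>" for \<nu>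
  proof -
    have ex: "\<exists>\<nu>'. infinite_card \<nu>' \<and> cardinal_suc \<nu>' = cardinal_suc \<nu>" using that by blast
    from someI_ex[OF this] show ?thesis
      unfolding base_def using ex that cardinal_suc_inject[OF inacc] by (auto simp: infinite_card_def)
  qed
  have base: "infinite_card (base \<mu>) \<and> \<mu> \<le> cardinal_suc (base \<mu>) \<and> (\<forall>\<kappa>. is_card \<kappa> \<and> \<kappa> < \<mu> \<longrightarrow> \<kappa> \<le> base \<mu>)"
    if \<mu>: "is_card \<mu>" for \<mu>
  proof (cases "\<exists>\<nu>. infinite_card \<nu> \<and> cardinal_suc \<nu> = \<mu>")
    case True
    then obtain \<nu> where \<nu>: "infinite_card \<nu>" "cardinal_suc \<nu> = \<mu>" by blast
    then have "base \<mu> = \<nu>" using base_suc by blast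
    then show ?thesis using \<nu> cardinal_suc_least[OF inacc] by (metis leD le_less_linear order_refl)
  next
    case False
    then have b: "base \<mu> = max aleph0 \<mu>" unfolding base_def by (rule if_not_P)
    have "infinite_card (max aleph0 \<mu>)"
      using infinite_card_aleph0[OF inacc] infinite_card_mono[OF inacc infinite_card_aleph0[OF inacc] \<mu>]
      by (auto simp: max_def)
    moreover have "max aleph0 \<mu> < cardinal_suc (max aleph0 \<mu>)" using cardinal_suc[OF inacc] by blast
    ultimately show ?thesis unfolding b by (auto simp: le_max_iff_disj)
  qed
  have "combinatorially_ER K lt big (\<lambda>\<mu> n. f (base \<mu>))"
    unfolding combinatorially_ER_def
  proof (intro conjI allI impI; (elim conjE)?)
    fix \<mu> :: 'o assume "is_card \<mu>"
    then show "is_card (f (base \<mu>))" using base ER unfolding strongly_ER_by_def by blast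
  next
    fix \<mu> \<kappa> :: 'o and n assume \<mu>: "is_card \<mu>" and \<kappa>: "is_card \<kappa>" "\<kappa> < \<mu>"
    let ?\<nu> = "base \<mu>"
    have \<nu>: "infinite_card ?\<nu>" "\<mu> \<le> cardinal_suc ?\<nu>" "\<kappa> \<le> ?\<nu>" using base[OF \<mu>] \<kappa> by blast+
    have \<chi>: "is_card (f ?\<nu>)" and S: "strongly_ER K lt big ?\<nu> (f ?\<nu>)"
      using ER \<nu>(1) unfolding strongly_ER_by_def by blast+
    have lt: "\<mu> < f ?\<nu>" using f[OF \<nu>(1)] \<nu>(2) by simp
    have "{..<?\<nu>} \<noteq> {}" using \<nu>(1) unfolding infinite_card_def by auto
    then have ar: "arrows K lt big (f ?\<nu>) \<mu> n ?\<nu>"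
      using arrows_if_strongly_ER[OF _ \<chi> S \<mu> lt] by blast
    have "aleph0 \<le> f ?\<nu>"
      using aleph0_le_infinite_card[OF inacc \<nu>(1)] f[OF \<nu>(1)] cardinal_suc[OF inacc, of ?\<nu>] by auto
    then show "arrows K lt big (f ?\<nu>) \<mu> n \<kappa>"
      using arrows_fewer_colours[OF ar \<nu>(3) _ \<chi>] arrows_no_colours[OF \<chi> _ \<mu>] lt
      by (cases "{..<\<kappa>} = {}") simp_all
  qed
  then show ?thesis using base_suc by (intro exI[of _ "\<lambda>\<mu> n. f (base \<mu>)"]) simp
qed


section \<open>One application of the partition relation\<close>

text \<open>
  The partition relation for labels that are subsets of \<open>\<mu>\<close>.  The function from types to labels is
  returned as a set of pairs \<open>Z\<close>, so that the possible functions are visibly the subsets of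
  \<open>S\<^sup>n \<times> \<mu>\<close>, which \<open>g_K\<close> counts.
\<close>
lemma homogeneous_labelling:
  assumes ER: "combinatorially_ER K lt big F" and \<theta>: "is_card \<theta>" "card_pow2 \<mu> < \<theta>"
    and I: "I \<in> big (F \<theta> n)" and h: "\<And>a. h a \<subseteq> {..<\<mu>}"
  shows "\<exists>I\<^sub>0\<in>big \<theta>. Le K I\<^sub>0 I \<and> (\<exists>Z. Z \<subseteq> inc_types K lt n \<times> {..<\<mu>} \<and>
    (\<forall>a. increasing lt I\<^sub>0 a \<and> length a = n \<longrightarrow> h a = {i. (tp K a I, i) \<in> Z}))"
proof -
  let ?\<kappa> = "card_pow2 \<mu> :: 'o"
  have "Pow {..<\<mu>} \<approx> {..<?\<kappa>}"
    unfolding card_pow2_def by (intro eqpoll_sym[OF cardinality_eqpoll] small_Pow_initial_segment inacc)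
  then obtain e where e: "bij_betw e (Pow {..<\<mu>}) {..<?\<kappa>}" unfolding eqpoll_def by blast
  have \<kappa>: "is_card ?\<kappa>"
    unfolding card_pow2_def by (intro is_card_cardinality small_Pow_initial_segment inacc)
  have "is_card (F \<theta> n)" and ar: "arrows K lt big (F \<theta> n) \<theta> n ?\<kappa>"
    using ER \<theta> \<kappa> unfolding combinatorially_ER_def by simp_all
  then have IK: "I \<in> Mem K" using big_mem I by blast
  (* At sets without an increasing enumeration the description is an arbitrary tuple, whose label
     is still a subset of mu. *)
  define c where "c s = e (h (THE a. increasing lt I a \<and> set a = s))" for s
  have "c s < ?\<kappa>" for s
    using h bij_betwE[OF e] unfolding c_def by blast
  then have "c ` nsets (univ I) n \<subseteq> {..<?\<kappa>}" by auto
  from ar[unfolded arrows_def, THEN bspec, OF I, THEN spec[of _ c], THEN mp, OF this]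
  obtain I0 c' where I0: "I0 \<in> big \<theta>" "Le K I0 I"
    and hom: "\<forall>a. increasing lt I0 a \<and> length a = n \<longrightarrow> c (set a) = c' (tp K a I)"
    unfolding type_homogeneous_def by blast
  define Z where "Z = {(p, i). p \<in> inc_types K lt n \<and> i < \<mu> \<and> i \<in> inv_into (Pow {..<\<mu>}) e (c' p)}"
  have "h a = {i. (tp K a I, i) \<in> Z}" if a: "increasing lt I0 a" "length a = n" for a
  proof -
    have inc: "increasing lt I a" using increasing_Le[OF I0(2) a(1)] .
    have "(THE b. increasing lt I b \<and> set b = set a) = a"
      by (rule the_equality) (use increasing_unique[OF IK _ inc] inc in simp_all)
    then have "c (set a) = e (h a)" unfolding c_def by (simp only:)
    moreover have "c (set a) = c' (tp K a I)" using hom a by blast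
    ultimately have "c' (tp K a I) = e (h a)" by simp
    moreover have "inv_into (Pow {..<\<mu>}) e (e (h a)) = h a"
      using h by (intro inv_into_f_f[OF bij_betw_imp_inj_on[OF e]]) blast
    ultimately have "inv_into (Pow {..<\<mu>}) e (c' (tp K a I)) = h a" by simp
    moreover have "tp K a I \<in> inc_types K lt n" using tp_in_inc_types[OF IK inc] a(2) by simp
    ultimately show ?thesis using h[of a] by (auto simp: Z_def)
  qed
  moreover have "Z \<subseteq> inc_types K lt n \<times> {..<\<mu>}" by (auto simp: Z_def)
  ultimately show ?thesis using I0 by blast
qed

lemma g_K_bounds:
  assumes \<mu>: "infinite_card \<mu>"
  shows "Pow (types K n \<times> {..<\<mu>}) \<lesssim> {..<g_K K \<mu>}" "card_pow2 \<mu> \<le> g_K K \<mu>" "infinite_card (g_K K \<mu>)"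
proof -
  let ?k = "\<lambda>n. card_mult \<mu> (cardinality (types K n)) :: 'o"
  let ?P = "range (\<lambda>n. card_pow2 (?k n))"
  have c: "is_card (card_pow2 \<kappa> :: 'o)" for \<kappa> :: 'o
    unfolding card_pow2_def by (intro is_card_cardinality small_Pow_initial_segment inacc)
  then have g: "is_card (g_K K \<mu>)"
    unfolding g_K_def by (intro is_card_ord_sup inacc small_range_nat) auto
  show bound: "Pow (types K n \<times> {..<\<mu>}) \<lesssim> {..<g_K K \<mu>}" for n
  proof -
    have "types K n \<lesssim> {..<cardinality (types K n) :: 'o}"
      by (rule lepoll_cardinality[OF small_types])
    then have "types K n \<times> {..<\<mu>} \<lesssim> {..<cardinality (types K n) :: 'o} \<times> {..<\<mu>}"
      by (intro times_lepoll_mono) simp_all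
    also have "\<dots> \<lesssim> {..<\<mu>} \<times> {..<cardinality (types K n) :: 'o}"
      by (rule eqpoll_imp_lepoll[OF times_commute_eqpoll])
    also have "\<dots> \<lesssim> {..<?k n}"
      unfolding card_mult_def
      by (intro lepoll_cardinality small_times inacc small_initial_segment)
    finally have "Pow (types K n \<times> {..<\<mu>}) \<lesssim> Pow {..<?k n}" by (rule Pow_lepoll_mono)
    also have "\<dots> \<lesssim> {..<card_pow2 (?k n) :: 'o}"
      unfolding card_pow2_def
      by (intro lepoll_cardinality small_Pow_initial_segment inacc)
    also have "\<dots> \<lesssim> {..<g_K K \<mu>}"
    proof -
      have "card_pow2 (?k n) \<le> g_K K \<mu>"
        unfolding g_K_def by (intro ord_sup_upper inacc small_range_nat) simp
      then show ?thesis by (intro subset_imp_lepoll) auto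
    qed
    finally show ?thesis .
  qed
  obtain p where p: "p \<in> types K 0" using types_0_nonempty by blast
  have le: "{..<\<mu>} \<lesssim> types K 0 \<times> {..<\<mu>}"
    unfolding lepoll_def using p by (intro exI[of _ "\<lambda>i. (p, i)"]) (auto simp: inj_on_def)
  have Pg: "Pow {..<\<mu>} \<lesssim> {..<g_K K \<mu>}" using lepoll_trans[OF Pow_lepoll_mono[OF le] bound] .
  have "{..<card_pow2 \<mu> :: 'o} \<approx> Pow {..<\<mu>}"
    unfolding card_pow2_def by (intro cardinality_eqpoll small_Pow_initial_segment inacc)
  then have "{..<card_pow2 \<mu> :: 'o} \<lesssim> {..<g_K K \<mu>}" using Pg lepoll_trans1 by blast
  then show "card_pow2 \<mu> \<le> g_K K \<mu>" using is_card_lepoll_iff[OF c] by blast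
  have "infinite {..<g_K K \<mu>}"
    using infinite_lepoll_mono[OF lepoll_trans[OF lepoll_Pow_self Pg]] \<mu>
    unfolding infinite_card_def by blast
  then show "infinite_card (g_K K \<mu>)" using g by (simp add: infinite_card_def)
qed

end


section \<open>The hierarchy of bignesses\<close>

locale daleth_hierarchy = class_with_bigness +
  fixes F :: "'a::wellorder \<Rightarrow> nat \<Rightarrow> 'a" and \<mu> :: 'a
  assumes ER: "combinatorially_ER K lt big F"
    and growth: "infinite_card \<nu> \<Longrightarrow> \<exists>n. \<nu> < F \<nu> n"
    and \<mu>: "infinite_card \<mu>"
begin

definition dal :: "'a \<Rightarrow> 'a" where
  "dal = daleth F"

definition height :: 'a where
  "height = cardinal_suc (g_K K \<mu>)"

lemma f_KF_eq: "f_KF K F \<mu> = dal height"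
  by (simp add: f_KF_def dal_def height_def)

lemma F_card: "is_card \<kappa> \<Longrightarrow> is_card (F \<kappa> n)"
  using ER unfolding combinatorially_ER_def by blast

lemma dal_infinite_card: "infinite_card (dal \<xi>)"
  using daleth_increasing[OF inacc F_card growth] unfolding dal_def by blast

lemma dal_is_card: "is_card (dal \<xi>)"
  using dal_infinite_card infinite_card_def by blast

lemma dal_less: "\<xi> < \<eta> \<Longrightarrow> dal \<xi> < dal \<eta>"
  using daleth_increasing[OF inacc F_card growth] unfolding dal_def by blast

lemma dal_mono: "\<xi> \<le> \<eta> \<Longrightarrow> dal \<xi> \<le> dal \<eta>"
  using dal_less by (metis le_less)

lemma le_dal: "\<xi> \<le> dal \<xi>"
  unfolding dal_def by (rule le_daleth[OF inacc]) (rule dal_less[unfolded dal_def])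

lemma F_le_dal: "F (dal \<xi>) n \<le> dal (ord_suc \<xi>)"
  unfolding dal_def daleth_suc[OF inacc] by (intro ord_sup_upper inacc small_range_nat) simp

lemma height_infinite_card: "infinite_card height"
  unfolding height_def
  using infinite_card_mono[OF inacc g_K_bounds(3)[OF \<mu>]]
    cardinal_suc[OF inacc, of "g_K K \<mu>"] by (simp add: less_imp_le)

lemma dal_cofinal:
  assumes "\<alpha> < dal height"
  shows "\<exists>\<xi><height. \<alpha> < dal \<xi>"
proof -
  have "{..<height} \<noteq> {}" using height_infinite_card unfolding infinite_card_def by auto
  moreover have "ord_suc \<xi> \<noteq> height" if "\<xi> < height" for \<xi>
    using infinite_card_is_limit[OF inacc height_infinite_card that] by simp
  ultimately have "dal height = ord_sup (dal ` {..<height})" unfolding dal_def by (rule daleth_limit)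
  then show ?thesis using less_ord_supD[OF inacc, of \<alpha> "dal ` {..<height}"] assms by auto
qed

end


section \<open>Building the blueprint\<close>

text \<open>
  The data of the strong cofinal property for the language \<open>\<tau>\<close>: one map into a \<open>\<tau>\<close>-structure for each
  cardinal below \<open>f_KF K F \<mu>\<close>.
\<close>
locale mapped_family = daleth_hierarchy +
  fixes \<tau> :: "'a lang" and M I :: "'a \<Rightarrow> 'a structr" and f :: "'a \<Rightarrow> 'a \<Rightarrow> 'a"
  assumes \<tau>: "language \<tau>" "lang_card_le \<tau> \<mu>"
    and fam: "is_card \<alpha> \<Longrightarrow> \<alpha> < dal height \<Longrightarrow>
      is_struct \<tau> (M \<alpha>) \<and> I \<alpha> \<in> big \<alpha> \<and> f \<alpha> ` univ (I \<alpha>) \<subseteq> univ (M \<alpha>)"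
begin

text \<open>
  The function \<open>\<Phi>\<close> is correct for tuples shorter than \<open>n\<close>, at each level \<open>\<xi>\<close> of the hierarchy.  The
  strict bound makes every \<open>\<Phi>\<close> correct at stage 0.
\<close>
definition homogeneous_stage :: "nat \<Rightarrow> ('a type \<Rightarrow> 'a type) \<Rightarrow> bool" where
  "homogeneous_stage n \<Phi> \<longleftrightarrow>
     (\<forall>\<xi><height. \<exists>\<beta> I'. is_card \<beta> \<and> dal \<xi> \<le> \<beta> \<and> \<beta> < dal height \<and> I' \<in> big (dal \<xi>) \<and> Le K I' (I \<beta>) \<and>
        (\<forall>a. increasing lt I' a \<and> length a < n \<longrightarrow>
           tp (all_structs \<tau>) (map (f \<beta>) a) (M \<beta>) = \<Phi> (tp K a (I \<beta>))))"

lemma family_mem: "is_card \<beta> \<Longrightarrow> \<beta> < dal height \<Longrightarrow> I \<beta> \<in> Mem K"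
  using fam big_mem by blast

lemma image_in_types:
  assumes "is_card \<beta>" "\<beta> < dal height" "set a \<subseteq> univ (I \<beta>)"
  shows "tp (all_structs \<tau>) (map (f \<beta>) a) (M \<beta>) \<in> types (all_structs \<tau>) (length a)"
proof -
  have "is_struct \<tau> (M \<beta>)" "set (map (f \<beta>) a) \<subseteq> univ (M \<beta>)"
    using fam[OF assms(1,2)] assms(3) by auto
  then show ?thesis unfolding types_def by (auto intro!: exI[of _ "map (f \<beta>) a"] exI[of _ "M \<beta>"])
qed

text \<open>
  The induction step of Morley's argument.  Quantifier-free types are coded by subsets of \<open>\<mu>\<close> through
  an injection \<open>d\<close>; homogeneity one level down yields for every \<open>\<xi>\<close> a function \<open>Z\<close> from types to
  codes, and the pigeonhole principle makes \<open>Z\<close> independent of \<open>\<xi>\<close>.  The new function is decoded from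
  the common value \<open>Y\<close>.
\<close>
lemma homogeneous_stage_Suc:
  assumes stage: "homogeneous_stage n \<Phi>"
  shows "\<exists>\<Phi>'. homogeneous_stage (Suc n) \<Phi>' \<and>
    (\<forall>p. p \<notin> inc_types K lt n \<longrightarrow> \<Phi>' p = \<Phi> p)"
proof -
  let ?T = "types (all_structs \<tau>) n"
  let ?g = "g_K K \<mu>"
  note g = g_K_bounds[OF \<mu>]
  have "?T \<lesssim> Pow {..<\<mu>}"
    using types_all_structs_lepoll[OF \<tau>(1)] \<mu> \<tau>(2)
    unfolding infinite_card_def lang_card_le_def by blast
  then obtain d where d: "inj_on d ?T" "d ` ?T \<subseteq> Pow {..<\<mu>}" unfolding lepoll_def by blast
  define good where "good \<xi> \<beta> I' Z \<longleftrightarrow>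
      is_card \<beta> \<and> dal \<xi> \<le> \<beta> \<and> \<beta> < dal height \<and> I' \<in> big (dal \<xi>) \<and> Le K I' (I \<beta>) \<and>
      Z \<subseteq> inc_types K lt n \<times> {..<\<mu>} \<and>
      (\<forall>a. increasing lt I' a \<and> length a < n \<longrightarrow>
         tp (all_structs \<tau>) (map (f \<beta>) a) (M \<beta>) = \<Phi> (tp K a (I \<beta>))) \<and>
      (\<forall>a. increasing lt I' a \<and> length a = n \<longrightarrow>
         d (tp (all_structs \<tau>) (map (f \<beta>) a) (M \<beta>)) = {i. (tp K a (I \<beta>), i) \<in> Z})"
    for \<xi> \<beta> I' and Z :: "('a type \<times> 'a) set"
  have "\<exists>\<beta> I' Z. good \<xi> \<beta> I' Z" if \<xi>: "\<xi> < height" for \<xi>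
  proof -
    (* Level zeta lies above the number 2^mu of colours, and the substructure is taken from
       the next level because homogeneity costs one level. *)
    let ?\<zeta> = "max \<xi> (ord_suc ?g)"
    have "?g < height" using cardinal_suc[OF inacc] height_def by simp
    then have "?\<zeta> < height" using infinite_card_is_limit[OF inacc height_infinite_card] \<xi> by simp
    then have "ord_suc ?\<zeta> < height" by (rule infinite_card_is_limit[OF inacc height_infinite_card])
    from stage[unfolded homogeneous_stage_def, rule_format, OF this]
    obtain \<beta> J where \<beta>: "is_card \<beta>" "dal (ord_suc ?\<zeta>) \<le> \<beta>" "\<beta> < dal height"
      and J: "J \<in> big (dal (ord_suc ?\<zeta>))" "Le K J (I \<beta>)"
      and hom: "\<And>a. increasing lt J a \<Longrightarrow> length a < n \<Longrightarrow>
        tp (all_structs \<tau>) (map (f \<beta>) a) (M \<beta>) = \<Phi> (tp K a (I \<beta>))"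
      by auto
    have le: "dal \<xi> \<le> dal ?\<zeta>" "dal ?\<zeta> \<le> dal (ord_suc ?\<zeta>)"
      by (rule dal_mono, simp) (rule dal_mono[OF less_imp_le[OF less_ord_suc[OF inacc]]])
    have "J \<in> big (F (dal ?\<zeta>) n)"
      using big_antimono[OF F_card[OF dal_is_card] dal_is_card F_le_dal J(1)] .
    moreover have "card_pow2 \<mu> < dal ?\<zeta>"
    proof -
      have "card_pow2 \<mu> \<le> ?g" by (rule g(2))
      also have "?g < ord_suc ?g" by (rule less_ord_suc[OF inacc])
      also have "\<dots> \<le> ?\<zeta>" by simp
      also have "\<dots> \<le> dal ?\<zeta>" by (rule le_dal)
      finally show ?thesis .
    qed
    (* The intersection changes nothing at the tuples that matter, whose code is a subset of mu;
       it keeps the label of any other list inside mu. *)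
    moreover define h where "h a = d (tp (all_structs \<tau>) (map (f \<beta>) a) (M \<beta>)) \<inter> {..<\<mu>}" for a
    moreover have "h a \<subseteq> {..<\<mu>}" for a by (simp add: h_def)
    ultimately have "\<exists>I0\<in>big (dal ?\<zeta>). Le K I0 J \<and> (\<exists>Z. Z \<subseteq> inc_types K lt n \<times> {..<\<mu>} \<and>
        (\<forall>a. increasing lt I0 a \<and> length a = n \<longrightarrow> h a = {i. (tp K a J, i) \<in> Z}))"
      by (intro homogeneous_labelling[OF ER dal_is_card])
    then obtain I0 Z where I0: "I0 \<in> big (dal ?\<zeta>)" "Le K I0 J"
      and Z: "Z \<subseteq> inc_types K lt n \<times> {..<\<mu>}"
      and lab: "\<And>a. increasing lt I0 a \<Longrightarrow> length a = n \<Longrightarrow> h a = {i. (tp K a J, i) \<in> Z}"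
      by blast
    have incJ: "increasing lt J a" if "increasing lt I0 a" for a
      using increasing_Le[OF I0(2) that] .
    have "good \<xi> \<beta> I0 Z"
      unfolding good_def
    proof (intro conjI allI impI; (elim conjE)?)
      show "is_card \<beta>" "\<beta> < dal height" "Z \<subseteq> inc_types K lt n \<times> {..<\<mu>}" by fact+
      show "dal \<xi> \<le> \<beta>" using le \<beta>(2) by simp
      show "I0 \<in> big (dal \<xi>)"
        using big_antimono[OF dal_is_card dal_is_card le(1) I0(1)] .
      show "Le K I0 (I \<beta>)" using abstract_classD(6)[OF abstract I0(2) J(2)] .
    next
      fix a assume "increasing lt I0 a" "length a < n"
      then show "tp (all_structs \<tau>) (map (f \<beta>) a) (M \<beta>) = \<Phi> (tp K a (I \<beta>))"
        using hom incJ by simp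
    next
      fix a assume a: "increasing lt I0 a" "length a = n"
      have aJ: "set a \<subseteq> univ J" using incJ[OF a(1)] by (simp add: increasing_def)
      have "set a \<subseteq> univ (I \<beta>)"
        using increasing_Le[OF J(2) incJ[OF a(1)]] by (simp add: increasing_def)
      then have "tp (all_structs \<tau>) (map (f \<beta>) a) (M \<beta>) \<in> ?T"
        using image_in_types[OF \<beta>(1,3)] a(2) by blast
      then have "h a = d (tp (all_structs \<tau>) (map (f \<beta>) a) (M \<beta>))" using d(2) by (auto simp: h_def)
      then show "d (tp (all_structs \<tau>) (map (f \<beta>) a) (M \<beta>)) = {i. (tp K a (I \<beta>), i) \<in> Z}"
        using lab[OF a] tp_Le[OF abstract J(2) aJ] by simp
    qed
    then show ?thesis by blast
  qed
  (* beta, I' and Z become functions of the level; the pigeonhole principle is applied to Z. *)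
  then obtain \<beta> I' Z where good: "\<And>\<xi>. \<xi> < height \<Longrightarrow> good \<xi> (\<beta> \<xi>) (I' \<xi>) (Z \<xi>)" by metis
  have "Z ` {..<height} \<subseteq> Pow (types K n \<times> {..<\<mu>})"
    using good inc_types_subset_types unfolding good_def by fastforce
  then have "Z ` {..<height} \<lesssim> {..<?g}" using g(1) lepoll_trans[OF subset_imp_lepoll] by blast
  then obtain Y where Y: "\<And>\<xi>. \<xi> < height \<Longrightarrow> \<exists>\<eta>. \<xi> \<le> \<eta> \<and> \<eta> < height \<and> Z \<eta> = Y"
    using pigeonhole_cardinal_suc[OF inacc, of ?g Z] g(3) unfolding height_def infinite_card_def by blast
  define \<Phi>' where "\<Phi>' p = (if p \<in> inc_types K lt n then inv_into ?T d {i. (p, i) \<in> Y} else \<Phi> p)" for p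
  have "homogeneous_stage (Suc n) \<Phi>'"
    unfolding homogeneous_stage_def
  proof (intro allI impI)
    fix \<xi> assume "\<xi> < height"
    then obtain \<eta> where \<eta>: "\<xi> \<le> \<eta>" "\<eta> < height" "Z \<eta> = Y" using Y by blast
    have le: "dal \<xi> \<le> dal \<eta>" using dal_mono \<eta>(1) .
    have G: "is_card (\<beta> \<eta>)" "dal \<eta> \<le> \<beta> \<eta>" "\<beta> \<eta> < dal height" "I' \<eta> \<in> big (dal \<eta>)" "Le K (I' \<eta>) (I (\<beta> \<eta>))"
      "\<And>a. increasing lt (I' \<eta>) a \<Longrightarrow> length a < n \<Longrightarrow>
         tp (all_structs \<tau>) (map (f (\<beta> \<eta>)) a) (M (\<beta> \<eta>)) = \<Phi> (tp K a (I (\<beta> \<eta>)))"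
      "\<And>a. increasing lt (I' \<eta>) a \<Longrightarrow> length a = n \<Longrightarrow>
         d (tp (all_structs \<tau>) (map (f (\<beta> \<eta>)) a) (M (\<beta> \<eta>))) = {i. (tp K a (I (\<beta> \<eta>)), i) \<in> Y}"
      using good[OF \<eta>(2)] \<eta>(3) unfolding good_def by simp_all
    have "tp (all_structs \<tau>) (map (f (\<beta> \<eta>)) a) (M (\<beta> \<eta>)) = \<Phi>' (tp K a (I (\<beta> \<eta>)))"
      if a: "increasing lt (I' \<eta>) a" "length a < Suc n" for a
    proof -
      have inc: "increasing lt (I (\<beta> \<eta>)) a" using increasing_Le[OF G(5) a(1)] .
      then have type: "tp K a (I (\<beta> \<eta>)) \<in> inc_types K lt (length a)"
        using tp_in_inc_types[OF family_mem[OF G(1,3)]] by blast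
      show ?thesis
      proof (cases "length a = n")
        case True
        have "set a \<subseteq> univ (I (\<beta> \<eta>))" using inc by (simp add: increasing_def)
        then have "tp (all_structs \<tau>) (map (f (\<beta> \<eta>)) a) (M (\<beta> \<eta>)) \<in> ?T"
          using image_in_types[OF G(1,3)] True by blast
        from inv_into_f_f[OF d(1) this] show ?thesis
          using type True unfolding G(7)[OF a(1) True] \<Phi>'_def by simp
      next
        case False
        then have "tp K a (I (\<beta> \<eta>)) \<notin> inc_types K lt n"
          using inc_types_disjoint[OF type] by blast
        then show ?thesis using G(6)[OF a(1)] a(2) False by (simp add: \<Phi>'_def)
      qed
    qed
    moreover have "I' \<eta> \<in> big (dal \<xi>)"
      using big_antimono[OF dal_is_card dal_is_card le G(4)] .
    moreover have "dal \<xi> \<le> \<beta> \<eta>" using le G(2) by simp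
    ultimately show "\<exists>\<beta> I'. is_card \<beta> \<and> dal \<xi> \<le> \<beta> \<and> \<beta> < dal height \<and> I' \<in> big (dal \<xi>) \<and> Le K I' (I \<beta>) \<and>
        (\<forall>a. increasing lt I' a \<and> length a < Suc n \<longrightarrow>
           tp (all_structs \<tau>) (map (f \<beta>) a) (M \<beta>) = \<Phi>' (tp K a (I \<beta>)))"
      using G(1,3,5) by (intro exI[of _ "\<beta> \<eta>"] exI[of _ "I' \<eta>"]) simp
  qed
  moreover have "\<forall>p. p \<notin> inc_types K lt n \<longrightarrow> \<Phi>' p = \<Phi> p" by (simp add: \<Phi>'_def)
  ultimately show ?thesis by blast
qed

text \<open>
  Successive stages change the function only on types of one new arity, and the sets of increasing types
  of different arities are disjoint; so the stages have a common limit.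
\<close>
lemma homogeneous_all_stages: "\<exists>\<Phi>. \<forall>n. homogeneous_stage n \<Phi>"
proof -
have "homogeneous_stage 0 \<Phi>" for \<Phi>
    unfolding homogeneous_stage_def
  proof (intro allI impI)
    fix \<xi> assume "\<xi> < height"
    then have "dal \<xi> < dal height" by (rule dal_less)
    then show "\<exists>\<beta> I'. is_card \<beta> \<and> dal \<xi> \<le> \<beta> \<and> \<beta> < dal height \<and> I' \<in> big (dal \<xi>) \<and> Le K I' (I \<beta>) \<and>
        (\<forall>a. increasing lt I' a \<and> length a < 0 \<longrightarrow>
           tp (all_structs \<tau>) (map (f \<beta>) a) (M \<beta>) = \<Phi> (tp K a (I \<beta>)))"
      using fam[OF dal_is_card] abstract_classD(5)[OF abstract family_mem[OF dal_is_card]] dal_is_card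
      by (intro exI[of _ "dal \<xi>"] exI[of _ "I (dal \<xi>)"]) simp
  qed
  then have "\<exists>\<Phi>s. \<forall>n. homogeneous_stage n (\<Phi>s n) \<and> (\<forall>p. p \<notin> inc_types K lt n \<longrightarrow> \<Phi>s (Suc n) p = \<Phi>s n p)"
    using homogeneous_stage_Suc by (intro dependent_nat_choice) auto
  then obtain \<Phi>s where stage: "\<And>n. homogeneous_stage n (\<Phi>s n)"
    and ext: "\<And>n p. p \<notin> inc_types K lt n \<Longrightarrow> \<Phi>s (Suc n) p = \<Phi>s n p" by blast
  note disj = inc_types_disjoint
  have agree: "\<Phi>s n p = \<Phi>s (Suc k) p" if "Suc k \<le> n" "p \<in> inc_types K lt k" for n k p
    using that(1)
  proof (induction n rule: dec_induct)
    case (step n)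
    then have "p \<notin> inc_types K lt n" using disj[OF that(2)] by fastforce
    then show ?case using ext step.IH by simp
  qed simp
  (* The stage after the arity of p is the first one at which the value at p is final. *)
  define \<Phi> where "\<Phi> p = \<Phi>s (Suc (THE n. p \<in> inc_types K lt n)) p" for p
  have \<Phi>: "\<Phi> p = \<Phi>s n p" if "p \<in> inc_types K lt k" "k < n" for p k n
  proof -
    have "(THE n. p \<in> inc_types K lt n) = k" 
      by (rule the_equality) (use that(1) disj in simp_all)
    then show ?thesis using agree[of k n p] that by (simp add: \<Phi>_def)
  qed
  have "homogeneous_stage n \<Phi>" for n
    unfolding homogeneous_stage_def
  proof (intro allI impI)
    fix \<xi> assume "\<xi> < height"
    from stage[of n, unfolded homogeneous_stage_def, rule_format, OF this]
    obtain \<beta> J where \<beta>: "is_card \<beta>" "dal \<xi> \<le> \<beta>" "\<beta> < dal height" and J: "J \<in> big (dal \<xi>)" "Le K J (I \<beta>)"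
      and hom: "\<And>a. increasing lt J a \<Longrightarrow> length a < n \<Longrightarrow>
        tp (all_structs \<tau>) (map (f \<beta>) a) (M \<beta>) = \<Phi>s n (tp K a (I \<beta>))"
      by auto
    have "\<Phi>s n (tp K a (I \<beta>)) = \<Phi> (tp K a (I \<beta>))" if "increasing lt J a" "length a < n" for a
      using \<Phi>[OF tp_in_inc_types[OF family_mem[OF \<beta>(1,3)]
            increasing_Le[OF J(2) that(1)]] that(2)] by simp
    then show "\<exists>\<beta> I'. is_card \<beta> \<and> dal \<xi> \<le> \<beta> \<and> \<beta> < dal height \<and> I' \<in> big (dal \<xi>) \<and> Le K I' (I \<beta>) \<and>
        (\<forall>a. increasing lt I' a \<and> length a < n \<longrightarrow>
           tp (all_structs \<tau>) (map (f \<beta>) a) (M \<beta>) = \<Phi> (tp K a (I \<beta>)))"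
      using \<beta> J hom by (intro exI[of _ \<beta>] exI[of _ J]) simp
  qed
  then show ?thesis by blast
qed

text \<open>
  A type \<open>p\<close> and all its restrictions are realised by one tuple \<open>a\<close> and its subtuples in a
  homogeneous structure.  There \<open>\<Phi>\<close> takes the types of their images as values, and restriction
  commutes with taking images.
\<close>
lemma blueprint_of_stages:
  assumes stage: "\<And>n. homogeneous_stage n \<Phi>"
  shows "blueprint K lt \<tau> \<Phi>"
  unfolding blueprint_def
proof (intro allI ballI)
  fix n p assume p: "p \<in> inc_types K lt n"
  have "g_K K \<mu> < height" using cardinal_suc[OF inacc] height_def by simp
  from stage[of "Suc n", unfolded homogeneous_stage_def, rule_format, OF this]
  obtain \<xi> \<beta> J where \<beta>: "is_card \<beta>" "\<beta> < dal height" and J: "J \<in> big (dal \<xi>)" "Le K J (I \<beta>)"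
    and hom: "\<And>a. increasing lt J a \<Longrightarrow> length a < Suc n \<Longrightarrow>
      tp (all_structs \<tau>) (map (f \<beta>) a) (M \<beta>) = \<Phi> (tp K a (I \<beta>))"
    by blast
  obtain a where a: "increasing lt J a" "length a = n" "tp K a J = p"
    using inc_types_realised[OF dal_is_card aleph0_le_infinite_card[OF inacc dal_infinite_card] J(1) p]
    by blast
  have aI: "set a \<subseteq> univ (I \<beta>)"
    using increasing_Le[OF J(2) a(1)] by (simp add: increasing_def)
  have "tp K a (I \<beta>) = p" using tp_Le[OF abstract J(2)] a by (simp add: increasing_def)
  then have \<Phi>p: "\<Phi> p = tp (all_structs \<tau>) (map (f \<beta>) a) (M \<beta>)" using hom[OF a(1)] a(2) by simp
  have "\<Phi> (tp_restrict K p s) = tp_restrict (all_structs \<tau>) (\<Phi> p) s" for s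
  proof -
    have len: "length (nths a s) < Suc n"
      using card_mono[of "{..<length a}" "{i. i < length a \<and> i \<in> s}"] a(2)
      by (simp add: length_nths subset_iff less_Suc_eq_le)
    have "tp_restrict K p s = tp K (nths a s) (I \<beta>)"
      using tp_restrict_tp[OF abstract family_mem[OF \<beta>] aI] \<open>tp K a (I \<beta>) = p\<close> by simp
    then have "\<Phi> (tp_restrict K p s) = tp (all_structs \<tau>) (nths (map (f \<beta>) a) s) (M \<beta>)"
      using hom[OF increasing_nths[OF a(1)] len] by (simp add: nths_map)
    also have "\<dots> = tp_restrict (all_structs \<tau>) (\<Phi> p) s"
      unfolding \<Phi>p using fam[OF \<beta>] aI
      by (intro tp_restrict_tp[symmetric] abstract_class_all_structs \<tau>(1)) auto
    finally show ?thesis .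
  qed
  then show "\<Phi> p \<in> types (all_structs \<tau>) n \<and>
      (\<forall>s\<subseteq>{..<n}. \<Phi> (tp_restrict K p s) = tp_restrict (all_structs \<tau>) (\<Phi> p) s)"
    using image_in_types[OF \<beta> aI] a(2) \<Phi>p by simp
qed

lemma exists_cofinally_homogeneous_blueprint:
  "\<exists>\<Phi>. blueprint K lt \<tau> \<Phi> \<and>
     (\<forall>\<alpha> n. is_card \<alpha> \<and> \<alpha> < dal height \<longrightarrow>
        (\<forall>\<gamma>. is_card \<gamma> \<and> \<gamma> < dal height \<longrightarrow>
           (\<exists>\<beta>. is_card \<beta> \<and> \<gamma> \<le> \<beta> \<and> \<beta> < dal height \<and>
              (\<exists>I'\<in>big \<alpha>. Le K I' (I \<beta>) \<and>
                 (\<forall>a. increasing lt I' a \<and> length a = n \<longrightarrow>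
                    tp (all_structs \<tau>) (map (f \<beta>) a) (M \<beta>) = \<Phi> (tp K a (I \<beta>)))))))"
proof -
  obtain \<Phi> where stage: "\<And>n. homogeneous_stage n \<Phi>"
    using homogeneous_all_stages by blast
  have "\<exists>\<beta>. is_card \<beta> \<and> \<gamma> \<le> \<beta> \<and> \<beta> < dal height \<and> (\<exists>I'\<in>big \<alpha>. Le K I' (I \<beta>) \<and>
      (\<forall>a. increasing lt I' a \<and> length a = n \<longrightarrow>
         tp (all_structs \<tau>) (map (f \<beta>) a) (M \<beta>) = \<Phi> (tp K a (I \<beta>))))"
    if \<alpha>: "is_card \<alpha>" "\<alpha> < dal height" and \<gamma>: "\<gamma> < dal height" for \<alpha> \<gamma> n
  proof -
    obtain \<xi> where \<xi>: "\<xi> < height" "max \<alpha> \<gamma> < dal \<xi>" using dal_cofinal[of "max \<alpha> \<gamma>"] \<alpha> \<gamma> by auto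
    from stage[of "Suc n", unfolded homogeneous_stage_def, rule_format, OF \<xi>(1)]
    obtain \<beta> J where \<beta>: "is_card \<beta>" "dal \<xi> \<le> \<beta>" "\<beta> < dal height" and J: "J \<in> big (dal \<xi>)" "Le K J (I \<beta>)"
      and hom: "\<And>a. increasing lt J a \<Longrightarrow> length a < Suc n \<Longrightarrow>
        tp (all_structs \<tau>) (map (f \<beta>) a) (M \<beta>) = \<Phi> (tp K a (I \<beta>))"
      by auto
    have "J \<in> big \<alpha>"
      using big_antimono[OF \<alpha>(1) dal_is_card _ J(1)] \<xi>(2) by (simp add: less_imp_le)
    moreover have "\<gamma> \<le> \<beta>"
      using less_le_trans[OF _ \<beta>(2), of \<gamma>] \<xi>(2) by (simp add: less_imp_le)
    ultimately show ?thesis using \<beta> J(2) hom by (intro exI[of _ \<beta>] conjI bexI[of _ J]) simp_all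
  qed
  then show ?thesis using blueprint_of_stages[OF stage] by (intro exI[of _ \<Phi>]) simp
qed


end


section \<open>The four implications\<close>

theorem theorem5p2:
  fixes K :: "'o::wellorder aclass" and lt :: 'o and big :: "'o \<Rightarrow> 'o structr set"
  assumes "inaccessible TYPE('o)"
    and "ordered_abstract_class K lt"
    and "bigness K big"
  shows
    "(\<forall>F. combinatorially_ER K lt big F \<and> (\<forall>\<mu>. infinite_card \<mu> \<longrightarrow> (\<exists>n. \<mu> < F \<mu> n)) \<longrightarrow>
        strongly_cofinally_ER_by K lt big (f_KF K F)) \<and>
     (\<forall>\<mu> \<chi>. is_card \<mu> \<and> is_card \<chi> \<and> strongly_cofinally_ER K lt big \<mu> \<chi> \<longrightarrow>
        strongly_ER K lt big \<mu> \<chi>) \<and>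
     (\<forall>\<mu> \<chi>. is_card \<mu> \<and> {..<\<mu>} \<noteq> {} \<and> is_card \<chi> \<and> strongly_ER K lt big \<mu> \<chi> \<longrightarrow>
        (\<forall>n \<theta>. is_card \<theta> \<and> \<theta> < \<chi> \<longrightarrow> arrows K lt big \<chi> \<theta> n \<mu>)) \<and>
     (\<forall>f. strongly_ER_by K lt big f \<and> (\<forall>\<mu>. infinite_card \<mu> \<longrightarrow> cardinal_suc \<mu> < f \<mu>) \<longrightarrow>
        (\<exists>F. (\<forall>\<mu> n. infinite_card \<mu> \<longrightarrow> F (cardinal_suc \<mu>) n = f \<mu>) \<and>
             combinatorially_ER K lt big F))"
proof -
  interpret class_with_bigness K lt big using assms by unfold_locales
  show ?thesis
  proof (intro conjI allI impI; elim conjE)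
    fix F assume ER: "combinatorially_ER K lt big F"
      and growth: "\<forall>\<mu>. infinite_card \<mu> \<longrightarrow> (\<exists>n. \<mu> < F \<mu> n)"
    show "strongly_cofinally_ER_by K lt big (f_KF K F)"
      unfolding strongly_cofinally_ER_by_def
    proof (intro allI impI)
      fix \<mu> :: 'o assume \<mu>: "infinite_card \<mu>"
      interpret H: daleth_hierarchy K lt big F \<mu>
        using ER growth \<mu> by unfold_locales simp_all
      have "strongly_cofinally_ER K lt big \<mu> (H.dal H.height)"
        unfolding strongly_cofinally_ER_def
      proof (intro allI impI, elim conjE)
        fix \<tau> M I f
        assume \<tau>: "language \<tau>" "lang_card_le \<tau> \<mu>"
          and fam: "\<forall>\<alpha>. is_card \<alpha> \<and> \<alpha> < H.dal H.height \<longrightarrow> is_struct \<tau> (M \<alpha>) \<and> I \<alpha> \<in> big \<alpha> \<and>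
            inj_on (f \<alpha>) (univ (I \<alpha>)) \<and> f \<alpha> ` univ (I \<alpha>) \<subseteq> univ (M \<alpha>)"
        interpret mapped_family K lt big F \<mu> \<tau> M I f
          using \<tau> fam by unfold_locales simp_all
        show "\<exists>\<Phi>. blueprint K lt \<tau> \<Phi> \<and>
           (\<forall>\<alpha> n. is_card \<alpha> \<and> \<alpha> < H.dal H.height \<longrightarrow>
              (\<forall>\<gamma>. is_card \<gamma> \<and> \<gamma> < H.dal H.height \<longrightarrow>
                 (\<exists>\<beta>. is_card \<beta> \<and> \<gamma> \<le> \<beta> \<and> \<beta> < H.dal H.height \<and>
                    (\<exists>I'\<in>big \<alpha>. Le K I' (I \<beta>) \<and>
                       (\<forall>a. increasing lt I' a \<and> length a = n \<longrightarrow>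
                          tp (all_structs \<tau>) (map (f \<beta>) a) (M \<beta>) = \<Phi> (tp K a (I \<beta>)))))))"
          by (rule exists_cofinally_homogeneous_blueprint)
      qed
      then show "is_card (f_KF K F \<mu>) \<and> strongly_cofinally_ER K lt big \<mu> (f_KF K F \<mu>)"
        using H.dal_is_card H.f_KF_eq by simp
    qed
  next
    fix \<mu> \<chi> assume "is_card \<chi>" "strongly_cofinally_ER K lt big \<mu> \<chi>"
    then show "strongly_ER K lt big \<mu> \<chi>" by (rule strongly_ER_if_strongly_cofinally_ER)
  next
    fix \<mu> \<chi> n \<theta>
    assume "{..<\<mu>} \<noteq> {}" "is_card \<chi>" "strongly_ER K lt big \<mu> \<chi>" "is_card \<theta>" "\<theta> < \<chi>"
    then show "arrows K lt big \<chi> \<theta> n \<mu>" by (rule arrows_if_strongly_ER)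
  next
    fix f assume "strongly_ER_by K lt big f" "\<forall>\<mu>. infinite_card \<mu> \<longrightarrow> cardinal_suc \<mu> < f \<mu>"
    then show "\<exists>F. (\<forall>\<mu> n. infinite_card \<mu> \<longrightarrow> F (cardinal_suc \<mu>) n = f \<mu>) \<and> combinatorially_ER K lt big F"
      by (intro combinatorially_ER_if_strongly_ER_by) simp_all
  qed
qed

end
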